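(* EPG Subgraph can be solved in time $\mathcal{O}(n^{h}\cdot \max(L_{\mathcal{G}})^{h^2}) \cdot 2^{\mathcal{O}(\sqrt{h\log h})}$, where $n$ is the number of vertices of the underlying graph, $h$ is the number of vertices of $H$, and $\max(L_{\mathcal{G}})$ is the maximum length of an edge label.
   Context: An edge periodic temporal graph (EPG) $\mathcal{G}=(V,E,\tau)$ consists of an undirected graph $G=(V,E)$ and a map $\tau: E\to\{0,1\}^*$ assigning each edge a nonempty binary label containing at least one $1$; edge $e$ is present at time step $t\ge0$ iff $\tau(e)[t\bmod|\tau(e)|]=1$. $L_{\mathcal{G}}=\{|\tau(e)| : e\in E\}$. The snapshot $\mathcal{G}(t)$ is $(V,\{e\in E: e \text{ present at } t\})$. "Subgraph" means induced subgraph (up to isomorphism). EPG Subgraph: given an EPG $\mathcal{G}$ and a graph $H$, decide whether there is a time step $t$ such that $H$ is an induced subgraph of $\mathcal{G}(t)$. *)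

theory Defs
  imports Complex_Main
begin

section \<open>Undirected graphs and edge periodic temporal graphs\<close>

record 'v ugraph =
  verts :: "'v set"
  edges :: "'v set set"

definition simple_graph :: "('v, 'z) ugraph_scheme \<Rightarrow> bool" where
  "simple_graph G \<longleftrightarrow> finite (verts G) \<and> (\<forall>e\<in>edges G. e \<subseteq> verts G \<and> card e = 2)"

definition induced_on :: "'v ugraph \<Rightarrow> 'v set \<Rightarrow> 'v ugraph" where
  "induced_on G W = \<lparr>verts = W, edges = {e \<in> edges G. e \<subseteq> W}\<rparr>"

definition isomorphic :: "'v ugraph \<Rightarrow> 'w ugraph \<Rightarrow> bool" where
  "isomorphic G H \<longleftrightarrow>
     (\<exists>f. bij_betw f (verts G) (verts H) \<and>
          (\<forall>u\<in>verts G. \<forall>v\<in>verts G. {u, v} \<in> edges G \<longleftrightarrow> {f u, f v} \<in> edges H))"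

definition is_induced_subgraph_of :: "'w ugraph \<Rightarrow> 'v ugraph \<Rightarrow> bool" where
  "is_induced_subgraph_of H G \<longleftrightarrow> (\<exists>W. W \<subseteq> verts G \<and> isomorphic (induced_on G W) H)"

text \<open>The value of \<open>label G\<close> outside \<open>edges G\<close> is irrelevant.\<close>

record 'v epg = "'v ugraph" +
  label :: "'v set \<Rightarrow> bool list"

definition is_epg :: "'v epg \<Rightarrow> bool" where
  "is_epg G \<longleftrightarrow> simple_graph G \<and>
     (\<forall>e\<in>edges G. label G e \<noteq> [] \<and> True \<in> set (label G e))"

definition present :: "'v epg \<Rightarrow> 'v set \<Rightarrow> nat \<Rightarrow> bool" where
  "present G e t \<longleftrightarrow> label G e ! (t mod length (label G e))"

definition snapshot :: "'v epg \<Rightarrow> nat \<Rightarrow> 'v ugraph" where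
  "snapshot G t = \<lparr>verts = verts G, edges = {e \<in> edges G. present G e t}\<rparr>"

definition label_lengths :: "'v epg \<Rightarrow> nat set" where
  "label_lengths G = (\<lambda>e. length (label G e)) ` edges G"

text \<open>The maximum is undefined for an edgeless graph; the value is then fixed to be \<open>1\<close>,
  the least possible label length.\<close>

definition max_label_length :: "'v epg \<Rightarrow> nat" where
  "max_label_length G = (if edges G = {} then 1 else Max (label_lengths G))"

definition epg_subgraph :: "'v epg \<Rightarrow> 'w ugraph \<Rightarrow> bool" where
  "epg_subgraph G H \<longleftrightarrow> (\<exists>t. is_induced_subgraph_of H (snapshot G t))"


section \<open>Random access machines with unit cost\<close>

text \<open>
  A machine has registers and a memory, both indexed by and containing natural numbers.
  Registers are addressed by constants in the program, memory cells only indirectly through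
  a register. Every instruction takes one step. There is no multiplication, because
  multiplying unbounded numbers at unit cost would make the model unreasonably powerful.
  \<open>Sub\<close> is truncated subtraction. A program halts when the program counter leaves it.
\<close>

datatype instr =
    Const nat nat
  | Move nat nat
  | Add nat nat nat
  | Sub nat nat nat
  | Load nat nat
  | Store nat nat
  | Jump nat
  | JumpZero nat nat

type_synonym config = "nat \<times> (nat \<Rightarrow> nat) \<times> (nat \<Rightarrow> nat)"

fun exec_instr :: "instr \<Rightarrow> config \<Rightarrow> config" where
  "exec_instr (Const d k) (pc, R, M) = (Suc pc, R(d := k), M)"
| "exec_instr (Move d a) (pc, R, M) = (Suc pc, R(d := R a), M)"
| "exec_instr (Add d a b) (pc, R, M) = (Suc pc, R(d := R a + R b), M)"
| "exec_instr (Sub d a b) (pc, R, M) = (Suc pc, R(d := R a - R b), M)"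
| "exec_instr (Load d a) (pc, R, M) = (Suc pc, R(d := M (R a)), M)"
| "exec_instr (Store a s) (pc, R, M) = (Suc pc, R, M(R a := R s))"
| "exec_instr (Jump l) (pc, R, M) = (l, R, M)"
| "exec_instr (JumpZero a l) (pc, R, M) = (if R a = 0 then l else Suc pc, R, M)"

definition step :: "instr list \<Rightarrow> config \<Rightarrow> config" where
  "step P c = (if fst c < length P then exec_instr (P ! fst c) c else c)"

definition initial :: "nat list \<Rightarrow> config" where
  "initial xs = (0, (\<lambda>_. 0), (\<lambda>i. if i < length xs then xs ! i else 0))"

text \<open>Since \<open>step\<close> leaves a halted configuration unchanged, the following says that \<open>P\<close>
  halts on input \<open>xs\<close> after at most \<open>t\<close> steps, with \<open>y\<close> in register \<open>0\<close>.\<close>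

definition halts_within :: "instr list \<Rightarrow> nat list \<Rightarrow> nat \<Rightarrow> nat \<Rightarrow> bool" where
  "halts_within P xs t y \<longleftrightarrow>
     (case (step P ^^ t) (initial xs) of (pc, R, M) \<Rightarrow> length P \<le> pc \<and> R 0 = y)"


section \<open>Inputs\<close>

text \<open>As inputs of an algorithm, the host graph and the pattern graph have vertices
  \<open>0, \<dots>, n - 1\<close> and \<open>0, \<dots>, h - 1\<close>.\<close>

definition is_instance :: "nat epg \<Rightarrow> nat ugraph \<Rightarrow> bool" where
  "is_instance G H \<longleftrightarrow> is_epg G \<and> simple_graph H \<and>
     verts G = {..<card (verts G)} \<and> verts H = {..<card (verts H)}"

text \<open>The host graph is given by its row-major adjacency matrix. The entry of an edge is the
  length of its label followed by the bits of the label; the entry of a non-edge is \<open>0\<close>.\<close>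

definition encode_entry :: "nat epg \<Rightarrow> nat \<Rightarrow> nat \<Rightarrow> nat list" where
  "encode_entry G u v =
     (if {u, v} \<in> edges G
      then length (label G {u, v}) # map of_bool (label G {u, v})
      else [0])"

definition encode :: "nat epg \<Rightarrow> nat ugraph \<Rightarrow> nat list" where
  "encode G H =
     (let n = card (verts G); h = card (verts H) in
      [n, h]
      @ concat (map (\<lambda>i. map (\<lambda>j. of_bool ({i, j} \<in> edges H)) [0..<h]) [0..<h])
      @ concat (map (\<lambda>u. concat (map (\<lambda>v. encode_entry G u v) [0..<n])) [0..<n]))"

end

theory Submission
  imports Defs
begin

text \<open>
  The algorithm enumerates all maps from the pattern into the host together with all time
  steps below \<open>m ^ (h * h)\<close>. This many time steps suffice, because presence of the at most
  \<open>h * h\<close> edges inside the image of a map is periodic with the product of their label lengths.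
  The outer loop advances the time: one pass over the host computes the current snapshot in
  \<open>O(n\<^sup>2)\<close> steps, which \<open>n ^ h\<close> dominates once \<open>h \<ge> 2\<close> (for smaller \<open>h\<close>, and for \<open>h > n\<close>,
  the answer is known without reading the graphs). The inner loop runs through the maps as the
  \<open>h\<close>-digit numbers in base \<open>n\<close>, so that no isomorphism test is needed, and spends \<open>O(h\<^sup>2)\<close>
  steps on each. Finally \<open>h\<^sup>2 \<le> 2 powr (2 * sqrt (h * log 2 h))\<close>, since \<open>log 2 h \<le> h\<close>.
\<close>

section \<open>Structured programs\<close>

text \<open>The input format and the machine dictate the order of the loops. Host entries have
  different lengths, so the address of the entry of \<open>{u, v}\<close> cannot be computed from
  \<open>u\<close> and \<open>v\<close>; and without multiplication and division neither
  \<open>t mod l\<close> nor \<open>n * u + v\<close> is available in one step. Testing a map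
  against the labels themselves would require searching the host for each map. With time outermost,
  the snapshot becomes a table with fixed-width rows, each remainder is a counter that grows by one
  per time step, and the multiples of the digits are updated along with the digits. The factor
  \<open>2 powr (c * sqrt (h * log 2 h))\<close> has the order of a classical bound for testing
  isomorphism of graphs on \<open>h\<close> vertices. Since \<open>n ^ h\<close> already counts maps
  instead of vertex sets, it only has to absorb the polynomial cost of checking one map.\<close>

datatype com =
    Block "instr list"
  | Seq com com  (infixr \<open>;;\<close> 60)
  | IfZero nat com com
  | While nat com

fun len :: "com \<Rightarrow> nat" where
  "len (Block is) = length is"
| "len (c ;; d) = len c + len d"
| "len (IfZero r c d) = len c + len d + 2"
| "len (While r c) = len c + 2"

text \<open>Jump targets are absolute, hence the start address \<open>p\<close>. The nonzero branch
  directly follows the test, so only that branch has to jump over the other one.\<close>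

fun compile :: "nat \<Rightarrow> com \<Rightarrow> instr list" where
  "compile p (Block is) = is"
| "compile p (c ;; d) = compile p c @ compile (p + len c) d"
| "compile p (IfZero r c d) =
     [JumpZero r (p + len d + 2)] @ compile (p + 1) d @
     [Jump (p + len d + 2 + len c)] @ compile (p + len d + 2) c"
| "compile p (While r c) =
     [JumpZero r (p + len c + 2)] @ compile (p + 1) c @ [Jump p]"

lemma length_compile [simp]: "length (compile p c) = len c"
  by (induction c arbitrary: p) auto

definition located :: "instr list \<Rightarrow> nat \<Rightarrow> instr list \<Rightarrow> bool" where
  "located P p xs \<longleftrightarrow> (\<exists>us vs. P = us @ xs @ vs \<and> length us = p)"

lemma located_append:
  "located P p (xs @ ys) \<longleftrightarrow> located P p xs \<and> located P (p + length xs) ys"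
proof
  assume "located P p (xs @ ys)"
  then obtain us vs where *: "P = us @ xs @ ys @ vs" "length us = p"
    unfolding located_def by auto
  have "located P p xs" unfolding located_def using * by blast
  moreover have "located P (p + length xs) ys" unfolding located_def
    using * by (intro exI[of _ "us @ xs"] exI[of _ vs]) auto
  ultimately show "located P p xs \<and> located P (p + length xs) ys" by blast
next
  assume "located P p xs \<and> located P (p + length xs) ys"
  then obtain us vs us' vs' where *: "P = us @ xs @ vs" "length us = p"
      "P = us' @ ys @ vs'" "length us' = p + length xs"
    unfolding located_def by metis
  have "us' = us @ xs"
    using * append_eq_append_conv[of us' "us @ xs" "ys @ vs'" vs] by simp
  then show "located P p (xs @ ys)" unfolding located_def using * by auto
qed

lemma step_located:
  "located P p (i # xs) \<Longrightarrow> step P (p, R, M) = exec_instr i (p, R, M)"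
  by (auto simp: located_def step_def nth_append)

text \<open>Total correctness of \<open>c\<close>, placed anywhere in a program, with \<open>b\<close> bounding the
  number of steps.\<close>

definition wp :: "com \<Rightarrow> nat \<Rightarrow> ((nat \<Rightarrow> nat) \<Rightarrow> (nat \<Rightarrow> nat) \<Rightarrow> bool)
    \<Rightarrow> (nat \<Rightarrow> nat) \<Rightarrow> (nat \<Rightarrow> nat) \<Rightarrow> bool" where
  "wp c b Q R M \<longleftrightarrow> (\<forall>P p. located P p (compile p c) \<longrightarrow>
     (\<exists>t R' M'. t \<le> b \<and> (step P ^^ t) (p, R, M) = (p + len c, R', M') \<and> Q R' M'))"

lemma wpI:
  assumes "\<And>P p. located P p (compile p c) \<Longrightarrow>
     \<exists>t R' M'. t \<le> b \<and> (step P ^^ t) (p, R, M) = (p + len c, R', M') \<and> Q R' M'"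
  shows "wp c b Q R M"
  using assms unfolding wp_def by blast

lemma wpE:
  assumes "wp c b Q R M" "located P p (compile p c)"
  obtains t R' M' where "t \<le> b" "(step P ^^ t) (p, R, M) = (p + len c, R', M')" "Q R' M'"
  using assms unfolding wp_def by blast

lemma wp_mono:
  assumes "wp c b Q R M" "b \<le> b'" "\<And>R' M'. Q R' M' \<Longrightarrow> Q' R' M'"
  shows "wp c b' Q' R M"
  using assms unfolding wp_def by (meson order_trans)

section \<open>Straight-line code\<close>

fun straight :: "instr \<Rightarrow> bool" where
  "straight (Jump l) = False"
| "straight (JumpZero r l) = False"
| "straight _ = True"

fun run :: "instr list \<Rightarrow> (nat \<Rightarrow> nat) \<times> (nat \<Rightarrow> nat) \<Rightarrow> (nat \<Rightarrow> nat) \<times> (nat \<Rightarrow> nat)" where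
  "run [] s = s"
| "run (i # is) (R, M) = run is (snd (exec_instr i (0, R, M)))"

lemma exec_straight:
  "straight i \<Longrightarrow> exec_instr i (p, R, M) = (Suc p, snd (exec_instr i (0, R, M)))"
  by (cases i) auto

lemma steps_block:
  assumes "list_all straight is" "located P p is"
  shows "(step P ^^ length is) (p, R, M) = (p + length is, run is (R, M))"
  using assms
proof (induction "is" arbitrary: p R M)
  case (Cons i "is")
  obtain R' M' where eff: "snd (exec_instr i (0, R, M)) = (R', M')" by fastforce
  have "located P p ([i] @ is)" using Cons.prems by simp
  then have "located P (Suc p) is" unfolding located_append by simp
  then have "(step P ^^ length is) (Suc p, R', M') = (Suc p + length is, run is (R', M'))"
    using Cons by auto
  moreover have "step P (p, R, M) = (Suc p, R', M')"
    using Cons.prems exec_straight[of i p R M] eff by (simp add: step_located)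
  ultimately show ?case by (simp add: funpow_Suc_right eff del: funpow.simps)
qed simp

lemma wp_block:
  assumes "list_all straight is" "case run is (R, M) of (R', M') \<Rightarrow> Q R' M'" "length is \<le> b"
  shows "wp (Block is) b Q R M"
proof (rule wpI)
  fix P p assume "located P p (compile p (Block is))"
  then show "\<exists>t R' M'. t \<le> b \<and> (step P ^^ t) (p, R, M) = (p + len (Block is), R', M') \<and> Q R' M'"
    using steps_block[of "is" P p R M] assms
    by (intro exI[of _ "length is"]) (auto split: prod.splits)
qed

section \<open>Sequencing, branching and loops\<close>

lemma wp_seq:
  assumes "wp c b S R M" "\<And>R M. S R M \<Longrightarrow> wp d b' Q R M" "b + b' \<le> b''"
  shows "wp (c ;; d) b'' Q R M"
proof (rule wpI)
  fix P p assume "located P p (compile p (c ;; d))"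
  then have l: "located P p (compile p c)" "located P (p + len c) (compile (p + len c) d)"
    by (simp_all add: located_append)
  obtain t R' M' where 1: "t \<le> b" "(step P ^^ t) (p, R, M) = (p + len c, R', M')" "S R' M'"
    using wpE[OF assms(1) l(1)] .
  obtain t' R'' M'' where 2: "t' \<le> b'" "Q R'' M''"
      "(step P ^^ t') (p + len c, R', M') = (p + len c + len d, R'', M'')"
    using wpE[OF assms(2)[OF 1(3)] l(2)] .
  have "(step P ^^ (t' + t)) (p, R, M) = (p + len (c ;; d), R'', M'')"
    using 1 2 by (simp add: funpow_add)
  then show "\<exists>t R' M'. t \<le> b'' \<and> (step P ^^ t) (p, R, M) = (p + len (c ;; d), R', M') \<and> Q R' M'"
    using 1 2 assms(3) by (intro exI[of _ "t' + t"]) auto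
qed

lemma wp_if:
  assumes "R r = 0 \<Longrightarrow> wp c b Q R M" "R r \<noteq> 0 \<Longrightarrow> wp d b Q R M" "b + 2 \<le> b'"
  shows "wp (IfZero r c d) b' Q R M"
proof (rule wpI)
  fix P p assume loc: "located P p (compile p (IfZero r c d))"
  then have l: "located P (Suc p) (compile (Suc p) d)"
      "located P (Suc (p + len d)) [Jump (p + len d + 2 + len c)]"
      "located P (p + len d + 2) (compile (p + len d + 2) c)"
    unfolding compile.simps located_append by auto
  have s: "step P (p, R, M) = (if R r = 0 then p + len d + 2 else Suc p, R, M)"
    using loc by (simp add: step_located)
  show "\<exists>t R' M'. t \<le> b' \<and> (step P ^^ t) (p, R, M) = (p + len (IfZero r c d), R', M') \<and> Q R' M'"
  proof (cases "R r = 0")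
    case True
    obtain t R' M' where "t \<le> b" "Q R' M'"
        "(step P ^^ t) (p + len d + 2, R, M) = (p + len d + 2 + len c, R', M')"
      using wpE[OF assms(1)[OF True] l(3)] .
    then show ?thesis using s True assms(3)
      by (intro exI[of _ "Suc t"]) (auto simp: funpow_Suc_right simp del: funpow.simps)
  next
    case False
    obtain t R' M' where "t \<le> b" "Q R' M'"
        "(step P ^^ t) (Suc p, R, M) = (Suc p + len d, R', M')"
      using wpE[OF assms(2)[OF False] l(1)] .
    moreover have "step P (Suc p + len d, R', M') = (p + len d + 2 + len c, R', M')"
      using l(2) by (simp add: step_located)
    ultimately show ?thesis using s False assms(3)
      apply (intro exI[of _ "Suc (Suc t)"])
      apply (subst funpow_Suc_right)
      apply auto
      done
  qed
qed

text \<open>Unfolds one iteration: the body has to establish the correctness of the remaining loop,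
  which leaves termination to an induction around this rule. The two extra steps are the test and
  the jump back.\<close>

lemma wp_while:
  assumes "R r = 0 \<Longrightarrow> Q R M" "R r \<noteq> 0 \<Longrightarrow> wp c b (wp (While r c) b' Q) R M"
    "b'' \<ge> (if R r = 0 then 1 else b + b' + 2)"
  shows "wp (While r c) b'' Q R M"
proof (rule wpI)
  fix P p assume loc: "located P p (compile p (While r c))"
  then have l: "located P (Suc p) (compile (Suc p) c)" "located P (Suc (p + len c)) [Jump p]"
    unfolding compile.simps located_append by auto
  have s: "step P (p, R, M) = (if R r = 0 then p + len c + 2 else Suc p, R, M)"
    using loc by (simp add: step_located)
  show "\<exists>t R' M'. t \<le> b'' \<and> (step P ^^ t) (p, R, M) = (p + len (While r c), R', M') \<and> Q R' M'"
  proof (cases "R r = 0")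
    case True
    then show ?thesis using s assms by (intro exI[of _ 1]) auto
  next
    case False
    obtain t R' M' where 1: "t \<le> b" "wp (While r c) b' Q R' M'"
        "(step P ^^ t) (Suc p, R, M) = (Suc p + len c, R', M')"
      using wpE[OF assms(2)[OF False] l(1)] .
    moreover have "step P (Suc p + len c, R', M') = (p, R', M')"
      using l(2) by (simp add: step_located)
    moreover obtain t' R'' M'' where "t' \<le> b'" "Q R'' M''"
        "(step P ^^ t') (p, R', M') = (p + len (While r c), R'', M'')"
      using wpE[OF 1(2) loc] .
    ultimately show ?thesis using s False assms(3)
      apply (intro exI[of _ "t' + Suc (Suc t)"])
      apply (subst funpow_add)
      apply (subst comp_apply)
      apply (subst funpow_Suc_right)
      apply auto
      done
  qed
qed

text \<open>Register \<open>1\<close> holds the constant \<open>1\<close> throughout.\<close>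

definition For :: "nat \<Rightarrow> com \<Rightarrow> com" where
  "For r c = While r (Block [Sub r r 1] ;; c)"

text \<open>The counter drops before the body, so iteration \<open>i\<close> runs with
  \<open>k - Suc i\<close> in it and must leave that value there. Test, decrement and jump add 3
  steps per iteration; the test that exits the loop is the final 1.\<close>

lemma wp_for:
  assumes "R r = k" "I 0 R M" "\<And>i R M. I i R M \<Longrightarrow> R 1 = 1"
    and body: "\<And>i R M. i < k \<Longrightarrow> I i R M \<Longrightarrow> R r = k - i \<Longrightarrow>
      wp c b (\<lambda>R M. I (Suc i) R M \<and> R r = k - Suc i) (R(r := k - Suc i)) M"
    and "\<And>R M. I k R M \<Longrightarrow> R r = 0 \<Longrightarrow> Q R M"
    and "k * (b + 3) + 1 \<le> b'"
  shows "wp (For r c) b' Q R M"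
proof -
  have "wp (For r c) ((k - i) * (b + 3) + 1) Q R M" if "i \<le> k" "I i R M" "R r = k - i" for i R M
    using that
  proof (induction "k - i" arbitrary: i R M)
    case 0
    then show ?case unfolding For_def by (intro wp_while) (auto intro: assms(5))
  next
    case (Suc j)
    have eq: "k - i = Suc (k - Suc i)" and "i < k" using Suc.hyps by auto
    have "wp (Block [Sub r r 1] ;; c) (Suc b)
            (wp (For r c) ((k - Suc i) * (b + 3) + 1) Q) R M"
    proof (rule wp_seq[where b' = b and b = 1])
      show "wp (Block [Sub r r 1]) 1 (\<lambda>R' M'. R' = R(r := k - Suc i) \<and> M' = M) R M"
        using assms(3)[OF Suc.prems(2)] Suc.prems by (intro wp_block) auto
      fix R' M' assume "R' = R(r := k - Suc i) \<and> M' = M"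
      then show "wp c b (wp (For r c) ((k - Suc i) * (b + 3) + 1) Q) R' M'"
        using Suc.prems Suc.hyps \<open>i < k\<close>
        by (auto intro!: wp_mono[OF body] Suc.hyps)
    qed simp
    then show ?case unfolding For_def using Suc.prems eq
      by (intro wp_while) (auto simp: algebra_simps)
  qed
  from this[of 0 R M] show ?thesis using assms by (auto intro: wp_mono)
qed

definition memory :: "nat list \<Rightarrow> nat \<Rightarrow> nat" where
  "memory xs = (\<lambda>i. if i < length xs then xs ! i else 0)"

lemma halts_within_compile:
  assumes "wp c b (\<lambda>R M. R 0 = y) (\<lambda>_. 0) (memory xs)"
  shows "\<exists>t\<le>b. halts_within (compile 0 c) xs t y"
proof -
  have "located (compile 0 c) 0 (compile 0 c)" unfolding located_def by auto
  with assms obtain t R' M' where "t \<le> b" "R' 0 = y"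
      "(step (compile 0 c) ^^ t) (initial xs) = (0 + len c, R', M')"
    unfolding wp_def initial_def memory_def by blast
  then show ?thesis unfolding halts_within_def by auto
qed

section \<open>Digits and lists\<close>

definition digit :: "nat \<Rightarrow> nat \<Rightarrow> nat \<Rightarrow> nat" where
  "digit n v i = v div n ^ i mod n"

lemma ex_digits:
  assumes "\<And>i. i < h \<Longrightarrow> f i < n"
  shows "\<exists>v<n ^ h. \<forall>i<h. digit n v i = f i"
  using assms
proof (induction h)
  case (Suc h)
  obtain v where v: "v < n ^ h" "\<And>i. i < h \<Longrightarrow> digit n v i = f i"
    using Suc by auto
  have f: "f h < n" using Suc by simp
  let ?w = "v + f h * n ^ h"
  have "?w < n ^ h + f h * n ^ h" using v(1) by simp
  also have "\<dots> = Suc (f h) * n ^ h" by simp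
  also have "\<dots> \<le> n * n ^ h" using f by (intro mult_le_mono1) simp
  finally have "?w < n ^ Suc h" by simp
  moreover have "digit n ?w i = f i" if "i < Suc h" for i
  proof (cases "i = h")
    case True
    then show ?thesis using v(1) f by (simp add: digit_def)
  next
    case False
    then have i: "i < h" using that by simp
    \<comment> \<open>A factor \<open>n\<close> remains beside \<open>n ^ i\<close>, so the new top
      term vanishes modulo \<open>n\<close> in digit \<open>i\<close>.\<close>
    have "n ^ h = n ^ i * (n * n ^ (h - Suc i))"
      using i by (simp flip: power_Suc power_add)
    then have eq: "?w = v + n ^ i * (n * (f h * n ^ (h - Suc i)))" by (simp only: ac_simps)
    have "?w div n ^ i = n * (f h * n ^ (h - Suc i)) + v div n ^ i"
      unfolding eq using f by (intro div_mult_self2) simp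
    then show ?thesis using v(2)[OF i] by (simp add: digit_def)
  qed
  ultimately show ?case by blast
qed auto

lemma digit_Suc:
  "digit n (Suc v) i =
     (if n ^ i dvd Suc v then if Suc (digit n v i) = n then 0 else Suc (digit n v i)
      else digit n v i)"
  unfolding digit_def div_Suc dvd_eq_mod_eq_0 using mod_Suc[of "v div n ^ i" n] by simp

text \<open>Carry propagation: once \<open>n ^ i\<close> divides \<open>Suc v\<close>, the next
  power does so exactly when the digit at \<open>i\<close> wraps to \<open>0\<close>.\<close>

lemma power_Suc_dvd_Suc_iff:
  "n ^ Suc i dvd Suc v \<longleftrightarrow> n ^ i dvd Suc v \<and> Suc (digit n v i) = n"
proof
  assume dv: "n ^ Suc i dvd Suc v"
  then have "n ^ i dvd Suc v" by (metis dvd_mult_right power_Suc)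
  moreover have "digit n (Suc v) i = 0"
    unfolding digit_def using dv by (metis dvd_imp_mod_0 dvd_mult_imp_div mult.commute power_Suc)
  ultimately show "n ^ i dvd Suc v \<and> Suc (digit n v i) = n"
    by (auto simp: digit_Suc split: if_splits)
next
  assume *: "n ^ i dvd Suc v \<and> Suc (digit n v i) = n"
  then have "digit n (Suc v) i = 0" using digit_Suc[of n v i] by simp
  then have "n dvd Suc v div n ^ i" by (simp add: digit_def mod_eq_0_iff_dvd)
  then show "n ^ Suc i dvd Suc v"
    by (metis * dvd_div_mult_self mult_dvd_mono dvd_refl power_Suc)
qed

lemma digit_power [simp]: "i < h \<Longrightarrow> 0 < n \<Longrightarrow> digit n (n ^ h) i = 0"
  by (simp add: digit_def flip: power_diff)

lemma digit_0 [simp]: "digit n 0 i = 0"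
  by (simp add: digit_def)

lemma digit_less: "0 < n \<Longrightarrow> digit n v i < n"
  by (simp add: digit_def)

section \<open>Offsets in concatenated lists\<close>

lemma length_concat_map_upt:
  "length (concat (map g [0..<N])) = (\<Sum>k<N. length (g k))"
  by (induction N) auto

lemma nth_concat_map_upt:
  assumes "k < N" "j < length (g k)"
  shows "(\<Sum>i<k. length (g i)) + j < length (concat (map g [0..<N]))"
    and "concat (map g [0..<N]) ! ((\<Sum>i<k. length (g i)) + j) = g k ! j"
proof -
  have "[0..<N] = [0..<k] @ k # [Suc k..<N]"
    using assms(1) by (metis less_imp_add_positive upt_add_eq_append upt_conv_Cons zero_le)
  then have "concat (map g [0..<N]) = concat (map g [0..<k]) @ g k @ concat (map g [Suc k..<N])"
    by simp
  then show "(\<Sum>i<k. length (g i)) + j < length (concat (map g [0..<N]))"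
      "concat (map g [0..<N]) ! ((\<Sum>i<k. length (g i)) + j) = g k ! j"
    using assms by (simp_all add: nth_append length_concat_map_upt)
qed

text \<open>Row-major order: the index \<open>k = u * n + v\<close> replaces two nested loops, so
  one program loop can walk through a whole matrix.\<close>

lemma concat_map_div_mod:
  "concat (map (\<lambda>u. concat (map (e u) [0..<n])) [0..<N]) =
   concat (map (\<lambda>k. e (k div n) (k mod n)) [0..<N * n])"
proof (induction N)
  case (Suc N)
  have "[0..<Suc N * n] = [0..<N * n] @ map (\<lambda>v. v + N * n) [0..<n]"
    by (metis add.commute add_0 map_add_upt mult_Suc upt_add_eq_append zero_le)
  moreover have "map (\<lambda>k. e (k div n) (k mod n)) (map (\<lambda>v. v + N * n) [0..<n]) = map (e N) [0..<n]"
    by simp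
  ultimately show ?case using Suc by (simp del: map_map)
qed simp

section \<open>Frames, tables and arithmetic by iteration\<close>

definition agree :: "(nat \<Rightarrow> nat) \<Rightarrow> (nat \<Rightarrow> nat) \<Rightarrow> bool" where
  "agree R R' \<longleftrightarrow> (\<forall>r<20. R' r = R r)"

lemma agree_refl [simp]: "agree R R"
  by (simp add: agree_def)

lemma agree_upd [simp]: "20 \<le> d \<Longrightarrow> agree R (R'(d := x)) = agree R R'"
  by (auto simp: agree_def)

text \<open>Register 1 occurs in two forms because the simplifier rewrites \<open>1\<close> to
  \<open>Suc 0\<close>.\<close>

lemma agreeD:
  assumes "agree R R'"
  shows "R' 0 = R 0" "R' (Suc 0) = R 1" "R' 1 = R 1" "R' 2 = R 2" "R' 3 = R 3" "R' 4 = R 4" "R' 5 = R 5"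
    "R' 6 = R 6" "R' 7 = R 7" "R' 8 = R 8" "R' 9 = R 9" "R' 10 = R 10" "R' 11 = R 11"
    "R' 12 = R 12" "R' 13 = R 13" "R' 14 = R 14" "R' 15 = R 15"
  using assms by (simp_all add: agree_def)

definition arr :: "(nat \<Rightarrow> nat) \<Rightarrow> nat \<Rightarrow> nat \<Rightarrow> (nat \<Rightarrow> nat) \<Rightarrow> bool" where
  "arr M b k f \<longleftrightarrow> (\<forall>i<k. M (b + i) = f i)"

lemma arrD: "arr M b k f \<Longrightarrow> i < k \<Longrightarrow> M (b + i) = f i"
  by (simp add: arr_def)

definition mult :: "nat \<Rightarrow> nat \<Rightarrow> nat \<Rightarrow> nat \<Rightarrow> com" where
  "mult d a b x = Block [Const d 0, Move x b] ;; For x (Block [Add d d a])"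

lemma wp_mult:
  assumes "R 1 = 1" "distinct [d, a, x, 1]" "b \<noteq> d"
  shows "wp (mult d a b x) (4 * R b + 3)
           (\<lambda>R' M'. R' = R(d := R a * R b, x := 0) \<and> M' = M) R M"
  unfolding mult_def
proof (rule wp_seq[where b = 2 and b' = "4 * R b + 1"])
  show "wp (Block [Const d 0, Move x b]) 2 (\<lambda>R' M'. R' = R(d := 0, x := R b) \<and> M' = M) R M"
    using assms by (intro wp_block) auto
  fix R' M' assume "R' = R(d := 0, x := R b) \<and> M' = M"
  then show "wp (For x (Block [Add d d a])) (4 * R b + 1)
         (\<lambda>R' M'. R' = R(d := R a * R b, x := 0) \<and> M' = M) R' M'"
    using assms
    apply (intro wp_for[where k = "R b" and b = 1
        and I = "\<lambda>i R' M'. R' = R(d := R a * i, x := R b - i) \<and> M' = M"])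
         apply (auto intro!: wp_block ext)
    done
qed simp

text \<open>The base, not the growing power, drives the inner addition loop, so each multiplication
  takes time linear in the base. The opposite order would cost time proportional to the power
  itself.\<close>

definition raise :: "nat \<Rightarrow> nat \<Rightarrow> nat \<Rightarrow> nat \<Rightarrow> nat \<Rightarrow> nat \<Rightarrow> com" where
  "raise d a e x y z = Block [Const d 1, Move x e] ;; For x (mult z d a y ;; Block [Move d z])"

lemma wp_raise:
  assumes "R 1 = 1" "distinct [d, a, x, y, z, 1]" "e \<notin> {d, x, y, z}"
  shows "wp (raise d a e x y z) (R e * (4 * R a + 7) + 3)
           (\<lambda>R' M'. R' d = R a ^ R e \<and> M' = M \<and> (\<forall>r. r \<notin> {d, x, y, z} \<longrightarrow> R' r = R r)) R M"
  unfolding raise_def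
proof (rule wp_seq[where b = 2 and b' = "R e * (4 * R a + 7) + 1"])
  show "wp (Block [Const d 1, Move x e]) 2 (\<lambda>R' M'. R' = R(d := 1, x := R e) \<and> M' = M) R M"
    using assms by (intro wp_block) auto
  fix R' M' assume *: "R' = R(d := 1, x := R e) \<and> M' = M"
  let ?I = "\<lambda>i R' M'. R' d = R a ^ i \<and> M' = M \<and> (\<forall>r. r \<notin> {d, x, y, z} \<longrightarrow> R' r = R r)"
  show "wp (For x (mult z d a y ;; Block [Move d z])) (R e * (4 * R a + 7) + 1)
         (?I (R e)) R' M'"
  proof (rule wp_for[where k = "R e" and b = "4 * R a + 4" and I = ?I])
    fix i R' M' assume I: "?I i R' M'"
    then show "R' 1 = 1" using assms by auto
    have [simp]: "R' a = R a" "R' 1 = 1" using I assms by auto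
    show "wp (mult z d a y ;; Block [Move d z]) (4 * R a + 4)
        (\<lambda>R' M'. ?I (Suc i) R' M' \<and> R' x = R e - Suc i) (R'(x := R e - Suc i)) M'"
      apply (rule wp_seq, rule wp_mult)
      using assms I by (auto intro!: wp_block)
  qed (use assms * in auto)
qed simp

section \<open>The program\<close>

text \<open>
  Registers from \<open>20\<close> on are scratch. Of the others, \<open>0\<close> counts the successful pairs of a
  time step and a map, \<open>14\<close> and \<open>15\<close> control the loops over these, \<open>2\<close> to \<open>8\<close> hold
  \<open>n, h, h * h, n * n, m, m ^ (h * h), n ^ h\<close>, and \<open>9\<close> to \<open>13\<close> the addresses of the host
  and of four tables behind the input: the snapshot, the time modulo each label length, the
  values of the current map, and \<open>n\<close> times these values (there is no multiplication).
\<close>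

definition pass :: com where
  "pass = Block [Move 20 5, Move 21 9, Move 22 10, Move 23 11] ;;
     For 20
       (Block [Load 24 21, Load 25 23, Add 21 21 1, Add 26 21 25, Load 26 26,
          Sub 27 26 24, Sub 26 26 27, Store 22 26,
          Add 25 25 1, Sub 27 24 25, Sub 28 25 24, Add 27 27 28] ;;
        IfZero 27 (Block [Const 25 0]) (Block []) ;;
        Block [Store 23 25, Add 21 21 24, Add 22 22 1, Add 23 23 1])"

text \<open>In truncated arithmetic \<open>1 - ((a - b) + (b - a))\<close> tests equality and \<open>a - (a - b)\<close> is the
  minimum, which serves as conjunction.\<close>

definition check_map :: com where
  "check_map = Block [Const 29 1, Const 25 2, Move 26 12, Move 27 13, Move 23 3] ;;
     For 23
       (Block [Move 28 12, Move 24 3] ;;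
        For 24
          (Block [Load 30 28, Load 31 26, Load 32 27, Add 32 32 30, Add 32 32 10, Load 32 32,
             Load 33 25, Sub 34 32 33, Sub 35 33 32, Add 34 34 35, Sub 29 29 34,
             Sub 34 31 30, Sub 35 30 31, Add 34 34 35, Sub 34 1 34,
             Sub 35 26 28, Sub 36 28 26, Add 35 35 36, Sub 35 34 35, Sub 34 34 35,
             Sub 29 29 34, Add 25 25 1, Add 28 28 1]) ;;
        Block [Add 26 26 1, Add 27 27 1]) ;;
     Block [Add 0 0 29]"

text \<open>An odometer step: the last map is followed by the zero map, so that no reset is needed
  between time steps.\<close>

definition advance :: com where
  "advance = Block [Move 20 3, Const 21 1, Move 22 2, Move 23 12, Move 24 13] ;;
     For 20
       (Block [Load 25 23, Add 25 25 21, Load 26 24, Add 26 26 22, Sub 27 2 25] ;;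
        IfZero 27 (Block [Const 25 0, Const 26 0]) (Block [Const 21 0, Const 22 0]) ;;
        Block [Store 23 25, Store 24 26, Add 23 23 1, Add 24 24 1])"

definition prepare :: com where
  "prepare = mult 4 3 3 20 ;; mult 5 2 2 20 ;;
     Block [Const 9 2, Add 9 9 4, Const 6 1, Move 10 9, Move 20 5] ;;
     For 20 (Block [Load 21 10, Sub 22 21 6, Add 6 6 22, Add 10 10 21, Add 10 10 1]) ;;
     raise 7 6 4 20 21 22 ;; raise 8 2 3 20 21 22 ;;
     Block [Const 0 0, Add 11 10 5, Add 12 11 5, Add 13 12 3]"

definition search :: com where
  "search = Block [Move 14 7] ;;
     For 14 (pass ;; Block [Move 15 8] ;; For 15 (check_map ;; advance)) ;;
     Block [Sub 20 1 0, Sub 0 1 20]"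

definition solver :: com where
  "solver = Block [Const 1 1, Load 2 0, Load 3 1, Sub 20 3 2, Sub 21 3 1] ;;
     IfZero 20 (IfZero 21 (Block [Const 0 1]) (prepare ;; search)) (Block [Const 0 0])"

section \<open>Correctness and running time of the program\<close>

text \<open>What the program relies on, with the graphs abstracted away: \<open>L k\<close> is the
  label length of matrix entry \<open>k\<close>, with \<open>0\<close> for a non-edge, and
  \<open>bit k t\<close> its presence at time \<open>t\<close>. The address \<open>start k\<close>
  skips the two sizes, the pattern matrix and the earlier entries. As all cells behind the input are
  zero, the tables are already correct for time 0 and map 0 without initialisation.\<close>

locale layout =
  fixes n h :: nat and x L pat :: "nat \<Rightarrow> nat" and bit :: "nat \<Rightarrow> nat \<Rightarrow> nat"
  fixes start :: "nat \<Rightarrow> nat"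
  defines "start k \<equiv> 2 + h * h + (\<Sum>i<k. Suc (L i))"
  assumes n_pos: "0 < n"
    and x_pat: "q < h * h \<Longrightarrow> x (2 + q) = pat q"
    and x_len: "k < n * n \<Longrightarrow> x (start k) = L k"
    and x_bit: "k < n * n \<Longrightarrow> 0 < L k \<Longrightarrow> x (Suc (start k) + t mod L k) = bit k t"
    and x_zero: "start (n * n) \<le> a \<Longrightarrow> x a = 0"
    and bit_0: "k < n * n \<Longrightarrow> L k = 0 \<Longrightarrow> bit k t = 0"
    and bit_le: "bit k t \<le> 1"
    and pat_le: "pat q \<le> 1"
begin

abbreviation "E \<equiv> start (n * n)"

lemma start_Suc: "start (Suc k) = Suc (start k + L k)"
  by (simp add: start_def)

lemma start_mono: "i \<le> j \<Longrightarrow> start i \<le> start j"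
  by (auto simp: start_def intro!: sum_mono2)

lemma start_less: "k < n * n \<Longrightarrow> start k + L k < E"
  using start_mono[of "Suc k" "n * n"] by (simp add: start_Suc)

lemma pat_region: "q < h * h \<Longrightarrow> 2 + q < E"
  by (simp add: start_def)

definition regs_ok :: "(nat \<Rightarrow> nat) \<Rightarrow> bool" where
  "regs_ok R \<longleftrightarrow> R 1 = 1 \<and> R 2 = n \<and> R 3 = h \<and> R 4 = h * h \<and> R 5 = n * n \<and> R 9 = 2 + h * h
     \<and> R 10 = E \<and> R 11 = E + n * n \<and> R 12 = E + 2 * (n * n) \<and> R 13 = E + 2 * (n * n) + h"

definition input_ok :: "(nat \<Rightarrow> nat) \<Rightarrow> bool" where
  "input_ok M \<longleftrightarrow> (\<forall>a<E. M a = x a)"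

definition counters_ok :: "nat \<Rightarrow> (nat \<Rightarrow> nat) \<Rightarrow> bool" where
  "counters_ok t M \<longleftrightarrow> arr M (E + n * n) (n * n) (\<lambda>k. t mod L k)"

definition digits_ok :: "nat \<Rightarrow> (nat \<Rightarrow> nat) \<Rightarrow> bool" where
  "digits_ok v M \<longleftrightarrow> arr M (E + 2 * (n * n)) h (digit n v) \<and>
     arr M (E + 2 * (n * n) + h) h (\<lambda>i. n * digit n v i)"

definition bits_ok :: "nat \<Rightarrow> (nat \<Rightarrow> nat) \<Rightarrow> bool" where
  "bits_ok t M \<longleftrightarrow> arr M E (n * n) (\<lambda>k. bit k t)"

text \<open>The second conjunct is injectivity. Comparing bits alone would also accept a map that
  merges two nonadjacent pattern vertices with equal neighbourhoods.\<close>

definition pair_ok :: "nat \<Rightarrow> nat \<Rightarrow> nat \<Rightarrow> nat \<Rightarrow> bool" where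
  "pair_ok t v i j \<longleftrightarrow> bit (n * digit n v i + digit n v j) t = pat (i * h + j) \<and>
     (digit n v i = digit n v j \<longrightarrow> i = j)"

definition map_ok :: "nat \<Rightarrow> nat \<Rightarrow> bool" where
  "map_ok t v \<longleftrightarrow> (\<forall>i<h. \<forall>j<h. pair_ok t v i j)"

section \<open>Snapshot, map test and odometer\<close>

lemma wp_pass:
  assumes "regs_ok R" "input_ok M" "counters_ok t M" "digits_ok v M"
  shows "wp pass (n * n * 22 + 5)
           (\<lambda>R' M'. agree R R' \<and> input_ok M' \<and> counters_ok (Suc t) M' \<and> digits_ok v M' \<and>
              bits_ok t M') R M"
  unfolding pass_def
proof (rule wp_seq[where b = 4 and b' = "n * n * 22 + 1"])
  let ?R = "R(20 := n * n, 21 := 2 + h * h, 22 := E, 23 := E + n * n)"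
  show "wp (Block [Move 20 5, Move 21 9, Move 22 10, Move 23 11]) 4
      (\<lambda>R' M'. R' = ?R \<and> M' = M) R M"
    using assms by (intro wp_block) (auto simp: regs_ok_def)
  fix R' M' assume *: "R' = ?R \<and> M' = M"
  have R1: "R 1 = 1" using assms by (simp add: regs_ok_def)
  let ?I = "\<lambda>k R' M'. agree R R' \<and> R' 21 = start k \<and> R' 22 = E + k \<and> R' 23 = E + n * n + k \<and>
     input_ok M' \<and> digits_ok v M' \<and> arr M' E k (\<lambda>k. bit k t) \<and>
     arr M' (E + n * n) (n * n) (\<lambda>i. if i < k then Suc t mod L i else t mod L i)"
  show "wp (For 20
       (Block [Load 24 21, Load 25 23, Add 21 21 1, Add 26 21 25, Load 26 26,
          Sub 27 26 24, Sub 26 26 27, Store 22 26,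
          Add 25 25 1, Sub 27 24 25, Sub 28 25 24, Add 27 27 28] ;;
        IfZero 27 (Block [Const 25 0]) (Block []) ;;
        Block [Store 23 25, Add 21 21 24, Add 22 22 1, Add 23 23 1])) (n * n * 22 + 1)
       (\<lambda>R' M'. agree R R' \<and> input_ok M' \<and> counters_ok (Suc t) M' \<and> digits_ok v M' \<and>
              bits_ok t M') R' M'"
  proof (rule wp_for[where k = "n * n" and b = 19 and I = ?I])
    show "?I 0 R' M'"
      using * assms by (auto simp: start_def counters_ok_def arr_def)
    fix k R' M' assume I: "?I k R' M'"
    then show "R' 1 = 1" using R1 by (auto dest: agreeD)
    assume k: "k < n * n"
    have r1: "R' (Suc 0) = 1" using I R1 by (auto dest: agreeD)
    have len: "M' (start k) = L k"
      using I start_less[OF k] x_len[OF k] by (simp add: input_ok_def)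
    have cnt: "M' (E + n * n + k) = t mod L k" using I k by (auto dest: arrD)
    let ?x = "M' (Suc (start k + t mod L k))"
    \<comment> \<open>For a non-edge \<open>?x\<close> lies outside the entry; taking the minimum with \<open>L k\<close> discards it.\<close>
    have bit: "?x - (?x - L k) = bit k t"
    proof (cases "L k = 0")
      case False
      then have "t mod L k < L k" by simp
      then have "Suc (start k + t mod L k) < E" using start_less[OF k] by linarith
      then have "?x = bit k t"
        using I x_bit[OF k, of t] False by (simp add: input_ok_def)
      then show ?thesis using bit_le[of k t] False by simp
    qed (use bit_0[OF k] in simp)
    \<comment> \<open>For a non-edge \<open>t mod 0 = t\<close>, and the program agrees: the
      incremented counter is positive, never equals the length \<open>0\<close>, and so is never
      reset.\<close>
    let ?c = "Suc (t mod L k)"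
    have upd: "input_ok (M'(E + k := b, E + n * n + k := c)) = input_ok M'"
        "digits_ok v (M'(E + k := b, E + n * n + k := c)) = digits_ok v M'" for b c
      using k by (auto simp: input_ok_def digits_ok_def arr_def)
    have bits: "arr (M'(E + k := bit k t, E + n * n + k := c)) E (Suc k) (\<lambda>k. bit k t)" for c
      using I k by (auto simp: arr_def less_Suc_eq)
    have cnts: "arr (M'(E + k := b, E + n * n + k := c)) (E + n * n) (n * n)
        (\<lambda>i. if i < Suc k then Suc t mod L i else t mod L i)" if "c = Suc t mod L k" for b c
      using I k that by (auto simp: arr_def less_Suc_eq)
    let ?R = "R'(20 := n * n - Suc k, 24 := L k, 25 := ?c, 21 := Suc (start k), 26 := bit k t,
       28 := ?c - L k, 27 := (L k - ?c) + (?c - L k))"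
    show "wp (Block [Load 24 21, Load 25 23, Add 21 21 1, Add 26 21 25, Load 26 26,
          Sub 27 26 24, Sub 26 26 27, Store 22 26,
          Add 25 25 1, Sub 27 24 25, Sub 28 25 24, Add 27 27 28] ;;
        IfZero 27 (Block [Const 25 0]) (Block []) ;;
        Block [Store 23 25, Add 21 21 24, Add 22 22 1, Add 23 23 1]) 19
        (\<lambda>R' M'. ?I (Suc k) R' M' \<and> R' 20 = n * n - Suc k) (R'(20 := n * n - Suc k)) M'"
    proof (rule wp_seq[where b = 12 and b' = 7])
      show "wp (Block [Load 24 21, Load 25 23, Add 21 21 1, Add 26 21 25, Load 26 26,
          Sub 27 26 24, Sub 26 26 27, Store 22 26,
          Add 25 25 1, Sub 27 24 25, Sub 28 25 24, Add 27 27 28]) 12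
          (\<lambda>R M. R = ?R \<and> M = M'(E + k := bit k t)) (R'(20 := n * n - Suc k)) M'"
        by (intro wp_block) (use I in \<open>simp_all add: r1 len cnt bit fun_upd_twist\<close>)
      fix R'' M'' assume **: "R'' = ?R \<and> M'' = M'(E + k := bit k t)"
      show "wp (IfZero 27 (Block [Const 25 0]) (Block []) ;;
        Block [Store 23 25, Add 21 21 24, Add 22 22 1, Add 23 23 1]) 7
        (\<lambda>R' M'. ?I (Suc k) R' M' \<and> R' 20 = n * n - Suc k) R'' M''"
      proof (rule wp_seq[where b = 3 and b' = 4])
        show "wp (IfZero 27 (Block [Const 25 0]) (Block [])) 3
           (\<lambda>R M. R = ?R(25 := Suc t mod L k) \<and> M = M'(E + k := bit k t)) R'' M''"
        proof (rule wp_if[where b = 1])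
          assume "R'' 27 = 0"
          then have "Suc t mod L k = 0" using ** by (simp add: mod_Suc)
          then show "wp (Block [Const 25 0]) 1
              (\<lambda>R M. R = ?R(25 := Suc t mod L k) \<and> M = M'(E + k := bit k t)) R'' M''"
            using ** by (intro wp_block) auto
        next
          assume "R'' 27 \<noteq> 0"
          then have "Suc t mod L k = ?c" using ** by (auto simp: mod_Suc)
          then show "wp (Block []) 1
              (\<lambda>R M. R = ?R(25 := Suc t mod L k) \<and> M = M'(E + k := bit k t)) R'' M''"
            using ** by (intro wp_block) (auto simp: fun_upd_twist)
        qed simp
        fix R3 M3 assume "R3 = ?R(25 := Suc t mod L k) \<and> M3 = M'(E + k := bit k t)"
        then show "wp (Block [Store 23 25, Add 21 21 24, Add 22 22 1, Add 23 23 1]) 4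
            (\<lambda>R' M'. ?I (Suc k) R' M' \<and> R' 20 = n * n - Suc k) R3 M3"
          using I by (intro wp_block) (auto simp: r1 upd bits cnts start_Suc)
      qed simp
    qed simp
  qed (use * assms in \<open>auto simp: counters_ok_def bits_ok_def arr_def\<close>)
qed simp

lemma wp_check_map:
  assumes "regs_ok R" "input_ok M" "digits_ok v M" "bits_ok t M"
  shows "wp check_map (h * (h * 26 + 8) + 7)
           (\<lambda>R' M'. agree (R(0 := R 0 + of_bool (map_ok t v))) R' \<and> M' = M) R M"
proof -
  have R: "R 1 = 1" "R (Suc 0) = 1" "R 10 = E" "R 12 = E + 2 * (n * n)" "R 13 = E + 2 * (n * n) + h" "R 3 = h"
    using assms by (auto simp: regs_ok_def)
  define b1 where "b1 = Block [Const 29 1, Const 25 2, Move 26 12, Move 27 13, Move 23 3]"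
  define b2 where "b2 = Block [Move 28 12, Move 24 3]"
  define b3 where "b3 = Block [Load 30 28, Load 31 26, Load 32 27, Add 32 32 30, Add 32 32 10, Load 32 32,
             Load 33 25, Sub 34 32 33, Sub 35 33 32, Add 34 34 35, Sub 29 29 34,
             Sub 34 31 30, Sub 35 30 31, Add 34 34 35, Sub 34 1 34,
             Sub 35 26 28, Sub 36 28 26, Add 35 35 36, Sub 35 34 35, Sub 34 34 35,
             Sub 29 29 34, Add 25 25 1, Add 28 28 1]"
  let ?F = "E + 2 * (n * n)"
  let ?row = "\<lambda>i. \<forall>j<h. pair_ok t v i j"
  let ?I = "\<lambda>i R' M'. agree R R' \<and> M' = M \<and> R' 29 = of_bool (\<forall>i'<i. ?row i') \<and>
     R' 25 = 2 + i * h \<and> R' 26 = ?F + i \<and> R' 27 = ?F + h + i"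
  let ?J = "\<lambda>i j R' M'. agree R R' \<and> M' = M \<and>
     R' 29 = of_bool ((\<forall>i'<i. ?row i') \<and> (\<forall>j'<j. pair_ok t v i j')) \<and>
     R' 25 = 2 + (i * h + j) \<and> R' 26 = ?F + i \<and> R' 27 = ?F + h + i \<and> R' 28 = ?F + j \<and>
     R' 23 = h - Suc i"
  have inner: "wp b3 23 (\<lambda>R' M'. ?J i (Suc j) R' M' \<and> R' 24 = h - Suc j)
                 (R'(24 := h - Suc j)) M'"
    if J: "?J i j R' M'" and i: "i < h" and j: "j < h" for i j R' M'
  proof -
    let ?d = "digit n v"
    let ?b = "bit (n * ?d i + ?d j) t" and ?p = "pat (i * h + j)"
    have q: "i * h + j < h * h"
    proof -
      have "i * h + j < Suc i * h" using j by simp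
      also have "\<dots> \<le> h * h" using i by (intro mult_le_mono1) simp
      finally show ?thesis .
    qed
    have k: "n * ?d i + ?d j < n * n"
    proof -
      have "n * ?d i + ?d j < n * Suc (?d i)" using digit_less[OF n_pos] by simp
      also have "\<dots> \<le> n * n" using digit_less[OF n_pos] by (intro mult_le_mono2) (simp add: Suc_le_eq)
      finally show ?thesis .
    qed
    have m: "M (?F + j) = ?d j" "M (?F + i) = ?d i" "M (?F + h + i) = n * ?d i"
      using assms(3) i j by (auto simp: digits_ok_def dest: arrD)
    have s: "M (n * ?d i + ?d j + E) = bit (n * ?d i + ?d j) t"
      using arrD[OF assms(4)[unfolded bits_ok_def] k] by (simp add: ac_simps)
    have p: "M (Suc (Suc (i * h + j))) = pat (i * h + j)"
      using assms(2) pat_region[OF q] x_pat[OF q] by (simp add: input_ok_def)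
    have r: "R' (Suc 0) = 1" "R' 10 = E" using J R by (auto dest: agreeD)
    \<comment> \<open>The flag in register 29 can only fall under truncated subtraction. The first
      amount subtracted is \<open>1\<close> iff the bits differ. The second is the minimum of the
      equality flag of the digits and the distance of \<open>i\<close> and \<open>j\<close>, the
      latter read off from two table addresses; it is \<open>1\<close> iff distinct positions
      collide.\<close>
    have ok: "of_bool P - (?b - ?p + (?p - ?b)) -
        ((Suc 0 - (?d i - ?d j + (?d j - ?d i))) -
         ((Suc 0 - (?d i - ?d j + (?d j - ?d i))) - (i - j + (j - i))))
        = (of_bool (P \<and> pair_ok t v i j) :: nat)" for P
      using bit_le[of "n * ?d i + ?d j" t] pat_le[of "i * h + j"]
      by (cases P; cases "?d i = ?d j"; cases "i = j"; cases "?b = ?p") (auto simp: pair_ok_def)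
    have conj: "((\<forall>i'<i. ?row i') \<and> (\<forall>j'<j. pair_ok t v i j')) \<and> pair_ok t v i j \<longleftrightarrow>
        (\<forall>i'<i. ?row i') \<and> (\<forall>j'<Suc j. pair_ok t v i j')"
      by (auto simp: less_Suc_eq)
    show ?thesis
      unfolding b3_def conj[symmetric] using J
      by (intro wp_block) (simp_all add: r m s p ok del: diff_diff_left)
  qed
  have row: "wp (b2 ;; For 24 b3 ;; Block [Add 26 26 1, Add 27 27 1]) (h * 26 + 5)
      (\<lambda>R' M'. ?I (Suc i) R' M' \<and> R' 23 = h - Suc i) (R'(23 := h - Suc i)) M'"
    if I: "?I i R' M'" and i: "i < h" for i R' M'
  proof (rule wp_seq[where b = 2 and b' = "h * 26 + 3"])
    have r: "R' 12 = ?F" "R' 3 = h" "R' (Suc 0) = 1"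
      using I R by (auto dest: agreeD)
    show "wp b2 2 (\<lambda>R' M'. ?J i 0 R' M' \<and> R' 24 = h) (R'(23 := h - Suc i)) M'"
      unfolding b2_def using I by (intro wp_block) (simp_all add: r)
    fix R2 M2 assume J: "?J i 0 R2 M2 \<and> R2 24 = h"
    show "wp (For 24 b3 ;; Block [Add 26 26 1, Add 27 27 1]) (h * 26 + 3)
      (\<lambda>R' M'. ?I (Suc i) R' M' \<and> R' 23 = h - Suc i) R2 M2"
    proof (rule wp_seq[where b = "h * 26 + 1" and b' = 2])
      show "wp (For 24 b3) (h * 26 + 1) (?J i h) R2 M2"
        using J inner[OF _ i] R(1)
        by (intro wp_for[where k = h and b = 23 and I = "?J i"]) (auto dest: agreeD)
      fix R3 M3 assume "?J i h R3 M3"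
      moreover from this have "R3 (Suc 0) = 1" using R by (auto dest: agreeD)
      ultimately show "wp (Block [Add 26 26 1, Add 27 27 1]) 2
          (\<lambda>R' M'. ?I (Suc i) R' M' \<and> R' 23 = h - Suc i) R3 M3"
        by (intro wp_block) (auto simp: less_Suc_eq)
    qed simp
  qed simp
  show ?thesis
    unfolding check_map_def b1_def[symmetric] b2_def[symmetric] b3_def[symmetric]
  proof (rule wp_seq[where b = 5 and b' = "h * (h * 26 + 8) + 2"])
    show "wp b1 5 (\<lambda>R' M'. ?I 0 R' M' \<and> R' 23 = h) R M"
      unfolding b1_def by (intro wp_block) (simp_all add: R)
    fix R2 M2 assume I: "?I 0 R2 M2 \<and> R2 23 = h"
    show "wp (For 23 (b2 ;; For 24 b3 ;; Block [Add 26 26 1, Add 27 27 1]) ;; Block [Add 0 0 29])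
      (h * (h * 26 + 8) + 2)
      (\<lambda>R' M'. agree (R(0 := R 0 + of_bool (map_ok t v))) R' \<and> M' = M) R2 M2"
    proof (rule wp_seq[where b = "h * (h * 26 + 8) + 1" and b' = 1])
      show "wp (For 23 (b2 ;; For 24 b3 ;; Block [Add 26 26 1, Add 27 27 1]))
          (h * (h * 26 + 8) + 1) (?I h) R2 M2"
        using I row R(1)
        by (intro wp_for[where k = h and b = "h * 26 + 5" and I = ?I]) (auto dest: agreeD)
      fix R3 M3 assume "?I h R3 M3"
      then show "wp (Block [Add 0 0 29]) 1
          (\<lambda>R' M'. agree (R(0 := R 0 + of_bool (map_ok t v))) R' \<and> M' = M) R3 M3"
        by (intro wp_block) (auto simp: map_ok_def agree_def)
    qed simp
  qed simp
qed

text \<open>The carry into digit \<open>i\<close> when passing from \<open>v\<close> to \<open>v + 1\<close> is \<open>1\<close> iff \<open>n ^ i\<close> divides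
  \<open>v + 1\<close>.\<close>

lemma wp_advance:
  assumes "regs_ok R" "digits_ok v M"
  shows "wp advance (h * 16 + 6)
           (\<lambda>R' M'. agree R R' \<and> digits_ok (Suc v) M' \<and> (\<forall>a<E + 2 * (n * n). M' a = M a)) R M"
  unfolding advance_def
proof (rule wp_seq[where b = 5 and b' = "h * 16 + 1"])
  let ?F = "E + 2 * (n * n)"
  have R: "R 1 = 1" "R 12 = ?F" "R 13 = ?F + h" "R 3 = h" "R 2 = n"
    using assms by (auto simp: regs_ok_def)
  let ?f = "\<lambda>i j. if j < i then digit n (Suc v) j else digit n v j"
  \<comment> \<open>Register 22 holds \<open>n\<close> times the carry, so the table of multiples is
    updated by additions alone. The sweep always covers all \<open>h\<close> digits; a carry that
    has died out just adds \<open>0\<close>.\<close>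
  let ?I = "\<lambda>i R' M'. agree R R' \<and> (\<forall>a<?F. M' a = M a) \<and>
     R' 21 = of_bool (n ^ i dvd Suc v) \<and> R' 22 = n * of_bool (n ^ i dvd Suc v) \<and>
     R' 23 = ?F + i \<and> R' 24 = ?F + h + i \<and> arr M' ?F h (?f i) \<and> arr M' (?F + h) h (\<lambda>j. n * ?f i j)"
  show "wp (Block [Move 20 3, Const 21 1, Move 22 2, Move 23 12, Move 24 13]) 5
     (\<lambda>R' M'. ?I 0 R' M' \<and> R' 20 = h) R M"
    using assms(2) by (intro wp_block) (simp_all add: R digits_ok_def)
  fix R1 M1 assume I: "?I 0 R1 M1 \<and> R1 20 = h"
  let ?b1 = "Block [Load 25 23, Add 25 25 21, Load 26 24, Add 26 26 22, Sub 27 2 25]"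
  let ?b2 = "IfZero 27 (Block [Const 25 0, Const 26 0]) (Block [Const 21 0, Const 22 0])"
  let ?b3 = "Block [Store 23 25, Store 24 26, Add 23 23 1, Add 24 24 1]"
  have body: "wp (?b1 ;; ?b2 ;; ?b3) 13 (\<lambda>R' M'. ?I (Suc i) R' M' \<and> R' 20 = h - Suc i)
       (R'(20 := h - Suc i)) M'"
    if I: "?I i R' M'" and i: "i < h" for i R' M'
  proof (rule wp_seq[where b = 5 and b' = 8])
    let ?d = "digit n v i"
    let ?c = "of_bool (n ^ i dvd Suc v) :: nat"
    let ?R = "R'(20 := h - Suc i, 25 := ?d + ?c, 26 := n * (?d + ?c), 27 := n - (?d + ?c))"
    have r: "R' 2 = n" "R' (Suc 0) = 1"
      using I R by (auto dest: agreeD)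
    have m: "M' (?F + i) = ?d" "M' (?F + h + i) = n * ?d"
      using I i by (auto simp: arr_def)
    show "wp ?b1 5 (\<lambda>R2 M2. R2 = ?R \<and> M2 = M') (R'(20 := h - Suc i)) M'"
      using I by (intro wp_block) (simp_all add: r m fun_upd_twist add_mult_distrib2)
    fix R2 M2 assume 2: "R2 = ?R \<and> M2 = M'"
    show "wp (?b2 ;; ?b3) 8 (\<lambda>R' M'. ?I (Suc i) R' M' \<and> R' 20 = h - Suc i) R2 M2"
    proof (rule wp_seq[where b = 4 and b' = 4])
      let ?Q = "\<lambda>R3 M3. agree R R3 \<and> M3 = M' \<and> R3 20 = h - Suc i \<and> R3 23 = ?F + i \<and> R3 24 = ?F + h + i \<and>
        R3 25 = digit n (Suc v) i \<and> R3 26 = n * digit n (Suc v) i \<and>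
        R3 21 = of_bool (n ^ Suc i dvd Suc v) \<and> R3 22 = n * of_bool (n ^ Suc i dvd Suc v)"
      have d: "?d < n" using digit_less[OF n_pos] .
      show "wp ?b2 4 ?Q R2 M2"
      proof (rule wp_if[where b = 2])
        assume "R2 27 = 0"
        \<comment> \<open>The digit is below \<open>n\<close>, so reaching \<open>n\<close> takes
          both an incoming carry and a maximal digit.\<close>
        then have "n ^ i dvd Suc v \<and> Suc ?d = n" using 2 d by (cases "n ^ i dvd Suc v") auto
        then show "wp (Block [Const 25 0, Const 26 0]) 2 ?Q R2 M2"
          using 2 I power_Suc_dvd_Suc_iff[of n i v] digit_Suc[of n v i]
          by (intro wp_block) (auto simp del: power_Suc)
      next
        assume "R2 27 \<noteq> 0"
        then have "\<not> (n ^ i dvd Suc v \<and> Suc ?d = n)" using 2 d by (cases "n ^ i dvd Suc v") auto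
        then show "wp (Block [Const 21 0, Const 22 0]) 2 ?Q R2 M2"
          using 2 I power_Suc_dvd_Suc_iff[of n i v] digit_Suc[of n v i]
          by (intro wp_block) (auto simp del: power_Suc)
      qed simp
      fix R3 M3 assume Q: "?Q R3 M3"
      then have r: "R3 (Suc 0) = 1" using R by (auto dest: agreeD)
      have a: "arr (M'(?F + i := y, ?F + h + i := z)) ?F h (?f (Suc i))"
        if "y = digit n (Suc v) i" for y z
        using I i that by (auto simp: arr_def less_Suc_eq)
      have b: "arr (M'(?F + i := y, ?F + h + i := z)) (?F + h) h (\<lambda>j. n * ?f (Suc i) j)"
        if "z = n * digit n (Suc v) i" for y z
        using I i that by (auto simp: arr_def less_Suc_eq)
      have c: "\<forall>a<?F. (M'(?F + i := y, ?F + h + i := z)) a = M a" for y z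
        using I by auto
      show "wp ?b3 4 (\<lambda>R' M'. ?I (Suc i) R' M' \<and> R' 20 = h - Suc i) R3 M3"
        using Q a b c by (intro wp_block) (simp_all add: r)
    qed simp
  qed simp
  show "wp (For 20 (?b1 ;; ?b2 ;; ?b3)) (h * 16 + 1)
     (\<lambda>R' M'. agree R R' \<and> digits_ok (Suc v) M' \<and> (\<forall>a<?F. M' a = M a)) R1 M1"
    using I body R(1)
    by (intro wp_for[where k = h and b = 13 and I = ?I])
       (auto dest: agreeD simp: digits_ok_def arr_def)
qed simp

end

section \<open>Preprocessing, main loops and case distinction\<close>

locale solver_run = layout +
  fixes m :: nat
  assumes len_le: "k < n * n \<Longrightarrow> L k \<le> m"
    and m_pos: "1 \<le> m"
    and m_attained: "m = 1 \<or> (\<exists>k<n * n. L k = m)"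
begin

text \<open>One scan of the host serves two ends: it finds \<open>m\<close>, and it leaves register
  10 at the end of the input, which is unknown before because entries vary in length. The maximum
  starts at 1, the value fixed for an edgeless host.\<close>

lemma wp_prepare:
  assumes "R 1 = 1" "R 2 = n" "R 3 = h"
  shows "wp prepare (4 * h + 4 * n + n * n * 8 + h * h * (4 * m + 7) + h * (4 * n + 7) + 22)
           (\<lambda>R' M'. regs_ok R' \<and> R' 0 = 0 \<and> R' 7 = m ^ (h * h) \<and> R' 8 = n ^ h \<and> M' = x) R x"
proof -
  let ?b1 = "Block [Const 9 2, Add 9 9 4, Const 6 1, Move 10 9, Move 20 5]"
  let ?b2 = "Block [Load 21 10, Sub 22 21 6, Add 6 6 22, Add 10 10 21, Add 10 10 1]"
  let ?b3 = "Block [Const 0 0, Add 11 10 5, Add 12 11 5, Add 13 12 3]"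
  let ?base = "\<lambda>R :: nat \<Rightarrow> nat. R 1 = 1 \<and> R 2 = n \<and> R 3 = h \<and> R 4 = h * h \<and> R 5 = n * n"
  let ?scan = "\<lambda>k R M. ?base R \<and> R 9 = 2 + h * h \<and> R 10 = start k \<and>
      1 \<le> R 6 \<and> (\<forall>i<k. L i \<le> R 6) \<and> R 6 \<le> m \<and> M = x"
  let ?full = "\<lambda>R (M :: nat \<Rightarrow> nat). ?base R \<and> R 9 = 2 + h * h \<and> R 10 = E \<and> R 6 = m \<and> M = x"
  let ?c1 = "4 * h + 3" and ?c2 = "4 * n + 3" and ?c3 = "n * n * 8 + 1"
    and ?c4 = "h * h * (4 * m + 7) + 3" and ?c5 = "h * (4 * n + 7) + 3"
  show ?thesis
    unfolding prepare_def
  proof (rule wp_seq[where b = ?c1 and b' = "?c2 + (5 + (?c3 + (?c4 + (?c5 + 4))))"])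
    show "wp (mult 4 3 3 20) ?c1
        (\<lambda>R M. R 1 = 1 \<and> R 2 = n \<and> R 3 = h \<and> R 4 = h * h \<and> M = x) R x"
      using assms by (intro wp_mono[OF wp_mult]) auto
    fix R M :: "nat \<Rightarrow> nat" assume 1: "R 1 = 1 \<and> R 2 = n \<and> R 3 = h \<and> R 4 = h * h \<and> M = x"
    show "wp (mult 5 2 2 20 ;; ?b1 ;; For 20 ?b2 ;; raise 7 6 4 20 21 22 ;; raise 8 2 3 20 21 22 ;; ?b3)
        (?c2 + (5 + (?c3 + (?c4 + (?c5 + 4)))))
        (\<lambda>R' M'. regs_ok R' \<and> R' 0 = 0 \<and> R' 7 = m ^ (h * h) \<and> R' 8 = n ^ h \<and> M' = x) R M"
    proof (rule wp_seq[where b = ?c2 and b' = "5 + (?c3 + (?c4 + (?c5 + 4)))"])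
      show "wp (mult 5 2 2 20) ?c2 (\<lambda>R M. ?base R \<and> M = x) R M"
        using 1 by (intro wp_mono[OF wp_mult]) auto
      fix R M :: "nat \<Rightarrow> nat" assume 2: "?base R \<and> M = x"
      show "wp (?b1 ;; For 20 ?b2 ;; raise 7 6 4 20 21 22 ;; raise 8 2 3 20 21 22 ;; ?b3)
          (5 + (?c3 + (?c4 + (?c5 + 4))))
          (\<lambda>R' M'. regs_ok R' \<and> R' 0 = 0 \<and> R' 7 = m ^ (h * h) \<and> R' 8 = n ^ h \<and> M' = x) R M"
      proof (rule wp_seq[where b = 5 and b' = "?c3 + (?c4 + (?c5 + 4))"])
        show "wp ?b1 5 (\<lambda>R M. ?scan 0 R M \<and> R 20 = n * n) R M"
          using 2 m_pos by (intro wp_block) (auto simp: start_def)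
        fix R M :: "nat \<Rightarrow> nat" assume 3: "?scan 0 R M \<and> R 20 = n * n"
        show "wp (For 20 ?b2 ;; raise 7 6 4 20 21 22 ;; raise 8 2 3 20 21 22 ;; ?b3)
            (?c3 + (?c4 + (?c5 + 4)))
            (\<lambda>R' M'. regs_ok R' \<and> R' 0 = 0 \<and> R' 7 = m ^ (h * h) \<and> R' 8 = n ^ h \<and> M' = x) R M"
        proof (rule wp_seq[where b = ?c3 and b' = "?c4 + (?c5 + 4)"])
          show "wp (For 20 ?b2) ?c3 ?full R M"
          proof (rule wp_for[where k = "n * n" and b = 5 and I = ?scan])
            fix k and R M :: "nat \<Rightarrow> nat" assume k: "k < n * n" and I: "?scan k R M"
            have one: "R (Suc 0) = 1" using I by simp
            have l: "x (start k) = L k" "L k \<le> m" using x_len[OF k] len_le[OF k] by auto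
            \<comment> \<open>Under truncated subtraction \<open>R 6 + (L k - R 6)\<close> is the
              maximum of the two numbers.\<close>
            have "\<forall>i<Suc k. L i \<le> R 6 + (L k - R 6)"
              using I by (auto simp: less_Suc_eq trans_le_add1)
            then show "wp ?b2 5 (\<lambda>R M. ?scan (Suc k) R M \<and> R 20 = n * n - Suc k)
                (R(20 := n * n - Suc k)) M"
              using I l by (intro wp_block) (auto simp: one start_Suc)
          next
            fix R M :: "nat \<Rightarrow> nat" assume I: "?scan (n * n) R M"
            have "m \<le> R 6" using I m_attained by auto
            then show "?full R M" using I by auto
          qed (use 3 in auto)
          fix R M :: "nat \<Rightarrow> nat" assume 4: "?full R M"
          show "wp (raise 7 6 4 20 21 22 ;; raise 8 2 3 20 21 22 ;; ?b3) (?c4 + (?c5 + 4))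
            (\<lambda>R' M'. regs_ok R' \<and> R' 0 = 0 \<and> R' 7 = m ^ (h * h) \<and> R' 8 = n ^ h \<and> M' = x) R M"
          proof (rule wp_seq[where b = ?c4 and b' = "?c5 + 4"])
            show "wp (raise 7 6 4 20 21 22) ?c4 (\<lambda>R M. ?full R M \<and> R 7 = m ^ (h * h)) R M"
              using 4 by (intro wp_mono[OF wp_raise]) auto
            fix R M :: "nat \<Rightarrow> nat" assume 5: "?full R M \<and> R 7 = m ^ (h * h)"
            show "wp (raise 8 2 3 20 21 22 ;; ?b3) (?c5 + 4)
              (\<lambda>R' M'. regs_ok R' \<and> R' 0 = 0 \<and> R' 7 = m ^ (h * h) \<and> R' 8 = n ^ h \<and> M' = x) R M"
            proof (rule wp_seq[where b = ?c5 and b' = 4])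
              show "wp (raise 8 2 3 20 21 22) ?c5
                  (\<lambda>R M. ?full R M \<and> R 7 = m ^ (h * h) \<and> R 8 = n ^ h) R M"
                using 5 by (intro wp_mono[OF wp_raise]) auto
              fix R M :: "nat \<Rightarrow> nat" assume "?full R M \<and> R 7 = m ^ (h * h) \<and> R 8 = n ^ h"
              then show "wp ?b3 4
                 (\<lambda>R' M'. regs_ok R' \<and> R' 0 = 0 \<and> R' 7 = m ^ (h * h) \<and> R' 8 = n ^ h \<and> M' = x) R M"
                by (intro wp_block) (auto simp: regs_ok_def)
            qed simp
          qed simp
        qed simp
      qed simp
    qed simp
  qed simp
qed

lemma regs_ok_agree: "regs_ok R \<Longrightarrow> agree (R(0 := y)) R' \<Longrightarrow> regs_ok R'"
  by (auto simp: regs_ok_def dest: agreeD)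

lemma regs_ok_upd: "d \<in> {0, 14, 15} \<or> 20 \<le> d \<Longrightarrow> regs_ok (R(d := y)) = regs_ok R"
  by (auto simp: regs_ok_def)

lemma wp_search:
  assumes "regs_ok R" "R 0 = 0" "R 7 = T" "R 8 = n ^ h"
  shows "wp search (T * (n * n * 22 + n ^ h * (h * (h * 26 + 24) + 16) + 10) + 4)
           (\<lambda>R' M'. R' 0 = of_bool (\<exists>t<T. \<exists>v<n ^ h. map_ok t v)) R x"
  unfolding search_def
proof (rule wp_seq[where b = 1 and
      b' = "T * (n * n * 22 + n ^ h * (h * (h * 26 + 24) + 16) + 10) + 3"])
  let ?N = "n ^ h"
  let ?found = "\<lambda>t. \<exists>t'<t. \<exists>v<?N. map_ok t' v"
  \<comment> \<open>Adding the flag of each map to register 0 needs no branch; of the resulting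
    count only positivity matters.\<close>
  let ?I = "\<lambda>t R M. regs_ok R \<and> R 8 = ?N \<and> input_ok M \<and> counters_ok t M \<and> digits_ok 0 M \<and>
     (0 < R 0 \<longleftrightarrow> ?found t)"
  let ?J = "\<lambda>t v R M. regs_ok R \<and> R 8 = ?N \<and> R 14 = T - Suc t \<and> input_ok M \<and>
     counters_ok (Suc t) M \<and> digits_ok v M \<and> bits_ok t M \<and>
     (0 < R 0 \<longleftrightarrow> ?found t \<or> (\<exists>v'<v. map_ok t v'))"
  have digits_cycle: "digits_ok ?N M = digits_ok 0 M" for M
    using n_pos by (auto simp: digits_ok_def arr_def)
  have inner: "wp (check_map ;; advance) (h * (h * 26 + 24) + 13)
      (\<lambda>R M. ?J t (Suc v) R M \<and> R 15 = ?N - Suc v) (R(15 := ?N - Suc v)) M"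
    if J: "?J t v R M" for t v R M
  proof (rule wp_seq[where b = "h * (h * 26 + 8) + 7" and b' = "h * 16 + 6"])
    let ?y = "R 0 + of_bool (map_ok t v)"
    show "wp check_map (h * (h * 26 + 8) + 7)
        (\<lambda>R' M'. agree (R(15 := ?N - Suc v, 0 := ?y)) R' \<and> M' = M)
        (R(15 := ?N - Suc v)) M"
      using J by (intro wp_mono[OF wp_check_map]) (auto simp: regs_ok_upd)
    fix R2 M2 assume 2: "agree (R(15 := ?N - Suc v, 0 := ?y)) R2 \<and> M2 = M"
    then have r2: "regs_ok R2" using J regs_ok_agree[of "R(15 := ?N - Suc v)" ?y R2] by (simp add: regs_ok_upd)
    show "wp advance (h * 16 + 6) (\<lambda>R M. ?J t (Suc v) R M \<and> R 15 = ?N - Suc v) R2 M2"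
    proof (rule wp_mono[OF wp_advance[OF r2]])
      show "digits_ok v M2" using J 2 by simp
      fix R3 M3 assume 3: "agree R2 R3 \<and> digits_ok (Suc v) M3 \<and>
        (\<forall>a<E + 2 * (n * n). M3 a = M2 a)"
      have "regs_ok R3" using 3 r2 by (auto simp: regs_ok_def dest: agreeD)
      moreover have "input_ok M3" "counters_ok (Suc t) M3" "bits_ok t M3"
        using J 2 3 by (auto simp: input_ok_def counters_ok_def bits_ok_def arr_def)
      moreover have "R3 8 = ?N" "R3 14 = T - Suc t" "R3 15 = ?N - Suc v" "R3 0 = ?y"
        using J agreeD[of "R(15 := ?N - Suc v, 0 := ?y)" R2] agreeD[of R2 R3] 2 3 by simp_all
      ultimately show "?J t (Suc v) R3 M3 \<and> R3 15 = ?N - Suc v"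
        using J 3 by (auto simp: less_Suc_eq)
    qed simp
  qed (simp add: algebra_simps)
  have outer: "wp (pass ;; Block [Move 15 8] ;; For 15 (check_map ;; advance))
      (n * n * 22 + ?N * (h * (h * 26 + 24) + 16) + 7)
      (\<lambda>R M. ?I (Suc t) R M \<and> R 14 = T - Suc t) (R(14 := T - Suc t)) M"
    if I: "?I t R M" for t R M
  proof (rule wp_seq[where b = "n * n * 22 + 5" and b' = "1 + (?N * (h * (h * 26 + 24) + 16) + 1)"])
    show "wp pass (n * n * 22 + 5) (?J t 0) (R(14 := T - Suc t)) M"
    proof (rule wp_mono[OF wp_pass])
      show "regs_ok (R(14 := T - Suc t))" using I by (simp add: regs_ok_upd)
      fix R2 M2
      assume "agree (R(14 := T - Suc t)) R2 \<and> input_ok M2 \<and> counters_ok (Suc t) M2 \<and>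
        digits_ok 0 M2 \<and> bits_ok t M2"
      then show "?J t 0 R2 M2" using I agreeD[of "R(14 := T - Suc t)" R2] by (simp add: regs_ok_def)
    qed (use I in auto)
    fix R2 M2 assume 2: "?J t 0 R2 M2"
    show "wp (Block [Move 15 8] ;; For 15 (check_map ;; advance))
        (1 + (?N * (h * (h * 26 + 24) + 16) + 1)) (\<lambda>R M. ?I (Suc t) R M \<and> R 14 = T - Suc t) R2 M2"
    proof (rule wp_seq[where b = 1 and b' = "?N * (h * (h * 26 + 24) + 16) + 1"])
      show "wp (Block [Move 15 8]) 1 (\<lambda>R M. ?J t 0 R M \<and> R 15 = ?N) R2 M2"
        using 2 by (intro wp_block) (auto simp: regs_ok_upd)
      fix R3 M3 assume 3: "?J t 0 R3 M3 \<and> R3 15 = ?N"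
      show "wp (For 15 (check_map ;; advance)) (?N * (h * (h * 26 + 24) + 16) + 1)
          (\<lambda>R M. ?I (Suc t) R M \<and> R 14 = T - Suc t) R3 M3"
      proof (rule wp_for[where k = ?N and I = "?J t" and b = "h * (h * 26 + 24) + 13"])
        fix v R M assume "?J t v R M"
        then show "R 1 = 1" by (simp add: regs_ok_def)
      next
        fix R M :: "nat \<Rightarrow> nat" assume "?J t ?N R M"
        then show "?I (Suc t) R M \<and> R 14 = T - Suc t"
          using digits_cycle by (auto simp: less_Suc_eq)
      qed (use 3 inner in auto)
    qed simp
  qed simp
  show "wp (Block [Move 14 7]) 1 (\<lambda>R M. ?I 0 R M \<and> R 14 = T) R x"
    using assms x_zero
    by (intro wp_block) (auto simp: regs_ok_upd input_ok_def counters_ok_def digits_ok_def arr_def)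
  fix R1 M1 assume 1: "?I 0 R1 M1 \<and> R1 14 = T"
  show "wp (For 14 (pass ;; Block [Move 15 8] ;; For 15 (check_map ;; advance)) ;;
      Block [Sub 20 1 0, Sub 0 1 20]) (T * (n * n * 22 + ?N * (h * (h * 26 + 24) + 16) + 10) + 3)
      (\<lambda>R' M'. R' 0 = of_bool (?found T)) R1 M1"
  proof (rule wp_seq[where b = "T * (n * n * 22 + ?N * (h * (h * 26 + 24) + 16) + 10) + 1" and b' = 2])
    show "wp (For 14 (pass ;; Block [Move 15 8] ;; For 15 (check_map ;; advance)))
       (T * (n * n * 22 + ?N * (h * (h * 26 + 24) + 16) + 10) + 1) (?I T) R1 M1"
    proof (rule wp_for[where k = T and I = ?I])
      fix t R M assume "?I t R M"
      then show "R 1 = 1" by (simp add: regs_ok_def)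
    next
      fix t R M assume "?I t R M"
      then show "wp (pass ;; Block [Move 15 8] ;; For 15 (check_map ;; advance))
          (n * n * 22 + ?N * (h * (h * 26 + 24) + 16) + 7)
          (\<lambda>R M. ?I (Suc t) R M \<and> R 14 = T - Suc t) (R(14 := T - Suc t)) M"
        by (rule outer)
    qed (use 1 in \<open>auto simp: algebra_simps\<close>)
    \<comment> \<open>Subtracting twice from \<open>1\<close> turns every positive count into
      \<open>1\<close> and keeps \<open>0\<close>.\<close>
    fix R M :: "nat \<Rightarrow> nat" assume "?I T R M"
    then show "wp (Block [Sub 20 1 0, Sub 0 1 20]) 2 (\<lambda>R' M'. R' 0 = of_bool (?found T)) R M"
      by (intro wp_block) (auto simp: regs_ok_def)
  qed simp
qed simp

lemma wp_solver:
  assumes "x 0 = n" "x 1 = h" "h \<le> n" "2 \<le> h"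
  shows "wp solver (4 * h + 4 * n + n * n * 8 + h * h * (4 * m + 7) + h * (4 * n + 7) +
             m ^ (h * h) * (n * n * 22 + n ^ h * (h * (h * 26 + 24) + 16) + 10) + 35)
           (\<lambda>R M. R 0 = of_bool (\<exists>t<m ^ (h * h). \<exists>v<n ^ h. map_ok t v)) (\<lambda>_. 0) x"
    (is "wp _ ?b ?Q _ _")
  unfolding solver_def
proof (rule wp_seq[where b = 5 and b' = "?b - 5"])
  let ?R = "(\<lambda>_. 0)(1 := 1, 2 := n, 3 := h, 20 := h - n, 21 := h - 1)"
  show "wp (Block [Const 1 1, Load 2 0, Load 3 1, Sub 20 3 2, Sub 21 3 1]) 5
     (\<lambda>R M. R = ?R \<and> M = x) (\<lambda>_. 0) x"
    using assms by (intro wp_block) auto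
  fix R M :: "nat \<Rightarrow> nat" assume R: "R = ?R \<and> M = x"
  have main: "wp (prepare ;; search) (?b - 9) ?Q R M"
  proof (rule wp_seq)
    show "wp prepare (4 * h + 4 * n + n * n * 8 + h * h * (4 * m + 7) + h * (4 * n + 7) + 22)
        (\<lambda>R' M'. regs_ok R' \<and> R' 0 = 0 \<and> R' 7 = m ^ (h * h) \<and> R' 8 = n ^ h \<and> M' = x) R M"
      using wp_prepare R by auto
    fix R M :: "nat \<Rightarrow> nat"
    assume "regs_ok R \<and> R 0 = 0 \<and> R 7 = m ^ (h * h) \<and> R 8 = n ^ h \<and> M = x"
    then show "wp search
       (m ^ (h * h) * (n * n * 22 + n ^ h * (h * (h * 26 + 24) + 16) + 10) + 4) ?Q R M"
      using wp_search by auto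
  qed simp
  show "wp (IfZero 20 (IfZero 21 (Block [Const 0 1]) (prepare ;; search)) (Block [Const 0 0]))
      (?b - 5) ?Q R M"
  proof (rule wp_if)
    show "wp (IfZero 21 (Block [Const 0 1]) (prepare ;; search)) (?b - 7) ?Q R M"
      using R assms by (intro wp_if[OF _ main]) auto
  qed (use R assms in auto)
qed simp

end

text \<open>Kept outside the locales, which assume \<open>0 < n\<close>: only the two sizes are read
  here, and the host may be empty.\<close>

lemma wp_solver_trivial:
  assumes "x 1 \<le> 1 \<or> x 0 < x 1"
  shows "wp solver 10 (\<lambda>R M. R 0 = of_bool (x 1 \<le> x 0)) (\<lambda>_. 0) x"
  unfolding solver_def
proof (rule wp_seq[where b = 5 and b' = 5])
  let ?R = "(\<lambda>_. 0)(1 := 1, 2 := x 0, 3 := x 1, 20 := x 1 - x 0, 21 := x 1 - 1)"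
  show "wp (Block [Const 1 1, Load 2 0, Load 3 1, Sub 20 3 2, Sub 21 3 1]) 5
     (\<lambda>R M. R = ?R \<and> M = x) (\<lambda>_. 0) x"
    by (intro wp_block) auto
  fix R M :: "nat \<Rightarrow> nat" assume R: "R = ?R \<and> M = x"
  show "wp (IfZero 20 (IfZero 21 (Block [Const 0 1]) (prepare ;; search)) (Block [Const 0 0])) 5
      (\<lambda>R M. R 0 = of_bool (x 1 \<le> x 0)) R M"
    by (rule wp_if[where b = 3], rule wp_if[where b = 1]; (rule wp_block)?)
       (use R assms in auto)
qed simp

section \<open>Instances in memory\<close>

text \<open>A non-edge counts as an empty label, so that every entry occupies one cell more than its
  length.\<close>

definition entry_length :: "nat epg \<Rightarrow> nat \<Rightarrow> nat" where
  "entry_length G k = (let n = card (verts G); e = {k div n, k mod n} in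
     if e \<in> edges G then length (label G e) else 0)"

definition entry_bit :: "nat epg \<Rightarrow> nat \<Rightarrow> nat \<Rightarrow> nat" where
  "entry_bit G k t = (let n = card (verts G); e = {k div n, k mod n} in
     of_bool (e \<in> edges G \<and> present G e t))"

definition pattern_bit :: "nat ugraph \<Rightarrow> nat \<Rightarrow> nat" where
  "pattern_bit H q = (let h = card (verts H) in of_bool ({q div h, q mod h} \<in> edges H))"

lemma encode_flat:
  "encode G H = (let n = card (verts G); h = card (verts H) in
     n # h # map (pattern_bit H) [0..<h * h] @
     concat (map (\<lambda>k. encode_entry G (k div n) (k mod n)) [0..<n * n]))"
proof -
  have single: "concat (map (\<lambda>j. [f j]) xs) = map f xs" for f :: "nat \<Rightarrow> nat" and xs
    by (induction xs) auto
  define h where "h = card (verts H)"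
  have "concat (map (\<lambda>i. map (\<lambda>j. of_bool ({i, j} \<in> edges H)) [0..<h]) [0..<h]) =
      map (pattern_bit H) [0..<h * h]"
    using concat_map_div_mod[of "\<lambda>i j. [of_bool ({i, j} \<in> edges H) :: nat]" h h]
    unfolding single by (simp add: pattern_bit_def h_def Let_def)
  then show ?thesis
    unfolding encode_def Let_def h_def concat_map_div_mod by simp
qed

lemma length_encode_entry:
  "n = card (verts G) \<Longrightarrow> length (encode_entry G (k div n) (k mod n)) = Suc (entry_length G k)"
  by (simp add: encode_entry_def entry_length_def Let_def)

locale epg_instance =
  fixes G :: "nat epg" and H :: "nat ugraph"
  assumes inst: "is_instance G H"
begin

abbreviation "n \<equiv> card (verts G)"
abbreviation "h \<equiv> card (verts H)"
abbreviation "m \<equiv> max_label_length G"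
abbreviation "x \<equiv> memory (encode G H)"
abbreviation "start k \<equiv> 2 + h * h + (\<Sum>i<k. Suc (entry_length G i))"

lemma verts_G: "verts G = {..<n}" and verts_H: "verts H = {..<h}"
  and edge_G: "e \<in> edges G \<Longrightarrow> e \<subseteq> {..<n} \<and> card e = 2"
  and edge_H: "e \<in> edges H \<Longrightarrow> e \<subseteq> {..<h} \<and> card e = 2"
  and label_G: "e \<in> edges G \<Longrightarrow> label G e \<noteq> []"
  using inst unfolding is_instance_def is_epg_def simple_graph_def by auto

lemma mem_verts_G: "v \<in> verts G \<longleftrightarrow> v < n" and mem_verts_H: "v \<in> verts H \<longleftrightarrow> v < h"
  using verts_G verts_H by auto

lemma finite_edges_G: "finite (edges G)"
proof (rule finite_subset)
  show "edges G \<subseteq> Pow {..<n}" using edge_G by auto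
qed simp

lemma x_0: "x 0 = n" and x_1: "x 1 = h"
  by (simp_all add: memory_def encode_flat Let_def)

lemma x_pattern:
  assumes "q < h * h"
  shows "x (2 + q) = pattern_bit H q"
  using assms by (simp add: memory_def encode_flat Let_def nth_append)

lemma x_entry:
  assumes "k < n * n" "j \<le> entry_length G k"
  shows "x (start k + j) = encode_entry G (k div n) (k mod n) ! j"
proof -
  let ?g = "\<lambda>k. encode_entry G (k div n) (k mod n)"
  have len: "length (?g k) = Suc (entry_length G k)" for k
    by (rule length_encode_entry) simp
  have j: "j < length (?g k)" using assms(2) by (simp add: len)
  show ?thesis
    using nth_concat_map_upt[of k "n * n" j ?g, OF assms(1) j]
    unfolding len by (simp add: memory_def encode_flat Let_def nth_append)
qed

lemma label_le: "e \<in> edges G \<Longrightarrow> length (label G e) \<le> m"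
  using finite_edges_G by (auto simp: max_label_length_def label_lengths_def)

lemma entry_length_le: "entry_length G k \<le> m"
  using label_le by (simp add: entry_length_def Let_def)

lemma edge_index:
  assumes "e \<in> edges G"
  obtains k where "k < n * n" "{k div n, k mod n} = e"
proof -
  obtain u v where uv: "e = {u, v}" using edge_G[OF assms] by (auto simp: card_2_iff)
  then have "u < n" "v < n" using edge_G[OF assms] by auto
  have "u * n + v < Suc u * n" using \<open>v < n\<close> by simp
  also have "\<dots> \<le> n * n" using \<open>u < n\<close> by (intro mult_le_mono1) simp
  finally have "u * n + v < n * n" .
  then show thesis using that[of "u * n + v"] uv \<open>v < n\<close> by simp
qed

lemma m_pos: "1 \<le> m"
proof (cases "edges G = {}")
  case False
  then obtain e where e: "e \<in> edges G" by auto
  then have "length (label G e) \<le> m" by (rule label_le)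
  moreover have "1 \<le> length (label G e)" using label_G[OF e] by (simp add: Suc_le_eq)
  ultimately show ?thesis by simp
qed (simp add: max_label_length_def)

lemma m_attained: "m = 1 \<or> (\<exists>k<n * n. entry_length G k = m)"
proof (cases "edges G = {}")
  case False
  then have "m \<in> label_lengths G" using finite_edges_G
    by (auto simp: max_label_length_def label_lengths_def intro!: Max_in)
  then obtain e where e: "e \<in> edges G" "m = length (label G e)" by (auto simp: label_lengths_def)
  obtain k where "k < n * n" "{k div n, k mod n} = e" using edge_index[OF e(1)] .
  then have "k < n * n" "entry_length G k = m" using e by (simp_all add: entry_length_def)
  then show ?thesis by blast
qed (simp add: max_label_length_def)

lemma solver_run:
  assumes "0 < n"
  shows "solver_run n h x (entry_length G) (pattern_bit H) (entry_bit G) m"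
proof unfold_locales
  fix k t assume k: "k < n * n"
  show "x (start k) = entry_length G k"
    using x_entry[OF k, of 0] by (simp add: encode_entry_def entry_length_def Let_def)
  assume "0 < entry_length G k"
  then have j: "t mod entry_length G k < entry_length G k" by simp
  show "x (Suc (start k) + t mod entry_length G k) = entry_bit G k t"
    using x_entry[OF k, of "Suc (t mod entry_length G k)"] j
    by (auto simp: encode_entry_def entry_length_def entry_bit_def present_def Let_def split: if_splits)
next
  fix a assume a: "start (n * n) \<le> a"
  have "length (encode G H) = start (n * n)"
    using length_encode_entry[OF refl, of G] by (simp add: encode_flat Let_def length_concat_map_upt)
  then show "x a = 0" using a by (simp add: memory_def)
next
  fix k t assume "entry_length G k = 0"
  then show "entry_bit G k t = 0"
    using label_G by (auto simp: entry_length_def entry_bit_def Let_def split: if_splits)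
qed (use assms x_pattern entry_length_le m_pos m_attained in
     \<open>auto simp: entry_bit_def pattern_bit_def Let_def\<close>)

end

section \<open>Embeddings and time steps\<close>

text \<open>Inverting the isomorphism turns the candidates into maps out of \<open>H\<close>, which
  digits can enumerate, instead of vertex sets that each come with an isomorphism problem.\<close>

lemma induced_subgraph_iff_embedding:
  "is_induced_subgraph_of H S \<longleftrightarrow>
     (\<exists>f. inj_on f (verts H) \<and> f ` verts H \<subseteq> verts S \<and>
        (\<forall>u\<in>verts H. \<forall>v\<in>verts H. {f u, f v} \<in> edges S \<longleftrightarrow> {u, v} \<in> edges H))"
  (is "_ \<longleftrightarrow> (\<exists>f. ?emb f)")
proof
  assume "is_induced_subgraph_of H S"
  then obtain W g where W: "W \<subseteq> verts S" and g: "bij_betw g W (verts H)"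
    and e: "\<And>u v. u \<in> W \<Longrightarrow> v \<in> W \<Longrightarrow> {u, v} \<in> edges S \<longleftrightarrow> {g u, g v} \<in> edges H"
    unfolding is_induced_subgraph_of_def isomorphic_def induced_on_def by auto
  let ?f = "inv_into W g"
  have f: "bij_betw ?f (verts H) W" using g by (rule bij_betw_inv_into)
  have "{?f u, ?f v} \<in> edges S \<longleftrightarrow> {u, v} \<in> edges H" if "u \<in> verts H" "v \<in> verts H" for u v
    using e[of "?f u" "?f v"] that f g by (simp add: bij_betwE bij_betw_inv_into_right)
  then have "?emb ?f" using f W by (simp add: bij_betw_def)
  then show "\<exists>f. ?emb f" by blast
next
  assume "\<exists>f. ?emb f"
  then obtain f where f: "?emb f" by blast
  let ?W = "f ` verts H" and ?g = "inv_into (verts H) f"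
  have "bij_betw ?g ?W (verts H)" using f by (simp add: inj_on_imp_bij_betw bij_betw_inv_into)
  moreover have "{u, v} \<in> edges (induced_on S ?W) \<longleftrightarrow> {?g u, ?g v} \<in> edges H"
    if "u \<in> ?W" "v \<in> ?W" for u v
    using f that by (auto simp: induced_on_def)
  ultimately have "isomorphic (induced_on S ?W) H"
    unfolding isomorphic_def by (intro exI[of _ ?g]) (simp add: induced_on_def)
  then show "is_induced_subgraph_of H S" using f unfolding is_induced_subgraph_of_def by blast
qed

context epg_instance
begin

definition embedding_at :: "nat \<Rightarrow> (nat \<Rightarrow> nat) \<Rightarrow> bool" where
  "embedding_at t f \<longleftrightarrow> inj_on f (verts H) \<and> (\<forall>i<h. f i < n) \<and>
     (\<forall>i<h. \<forall>j<h. {f i, f j} \<in> edges G \<and> present G {f i, f j} t \<longleftrightarrow> {i, j} \<in> edges H)"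

lemma epg_subgraph_iff: "epg_subgraph G H \<longleftrightarrow> (\<exists>t f. embedding_at t f)"
  unfolding epg_subgraph_def induced_subgraph_iff_embedding embedding_at_def snapshot_def
  by (simp add: image_subset_iff mem_verts_G Ball_def mem_verts_H)

text \<open>Digits reproduce a given map only at positions below \<open>h\<close>.\<close>

lemma embedding_at_cong:
  "(\<And>i. i < h \<Longrightarrow> f i = g i) \<Longrightarrow> embedding_at t f = embedding_at t g"
  unfolding embedding_at_def by (auto simp: inj_on_def mem_verts_H)

text \<open>The map is fixed before the time is reduced: only labels inside its image enter the
  period, whereas a common period of the whole host would involve every label.\<close>

lemma embedding_at_early:
  assumes "embedding_at t f"
  shows "\<exists>t'<m ^ (h * h). embedding_at t' f"
proof -
  \<comment> \<open>Ordered pairs, diagonal included, give exactly \<open>h * h\<close> factors.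
    Non-edges contribute the neutral \<open>1\<close>; that an edge is counted twice does no harm,
    as only divisibility is used.\<close>
  let ?l = "\<lambda>(i, j). if {f i, f j} \<in> edges G then length (label G {f i, f j}) else 1"
  let ?I = "{..<h} \<times> {..<h}"
  define D where "D = prod ?l ?I"
  have l: "1 \<le> ?l p" "?l p \<le> m" for p
    using label_G label_le m_pos by (auto simp: Suc_le_eq split: prod.splits)
  have "D \<le> (\<Prod>p\<in>?I. m)" unfolding D_def using l by (intro prod_mono) auto
  then have "D \<le> m ^ (h * h)" by simp
  moreover have "0 < D" unfolding D_def using l by (intro prod_pos) (auto simp: Suc_le_eq)
  ultimately have "t mod D < m ^ (h * h)" by (meson mod_less_divisor order_less_le_trans)
  moreover have "present G {f i, f j} (t mod D) = present G {f i, f j} t"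
    if "i < h" "j < h" "{f i, f j} \<in> edges G" for i j
  proof -
    have "?l (i, j) dvd D" unfolding D_def using that by (intro dvd_prodI) auto
    then have "length (label G {f i, f j}) dvd D" using that by simp
    then show ?thesis unfolding present_def by (simp add: mod_mod_cancel)
  qed
  then have "embedding_at (t mod D) f" using assms unfolding embedding_at_def by blast
  ultimately show ?thesis by blast
qed

lemma epg_subgraph_iff_digits:
  assumes "0 < n"
  shows "epg_subgraph G H \<longleftrightarrow> (\<exists>t<m ^ (h * h). \<exists>v<n ^ h. embedding_at t (digit n v))"
proof
  assume "epg_subgraph G H"
  then obtain t f where "t < m ^ (h * h)" and f: "embedding_at t f"
    using embedding_at_early unfolding epg_subgraph_iff by blast
  moreover obtain v where "v < n ^ h" "\<forall>i<h. digit n v i = f i"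
    using ex_digits[of h f n] f by (auto simp: embedding_at_def)
  ultimately show "\<exists>t<m ^ (h * h). \<exists>v<n ^ h. embedding_at t (digit n v)"
    using embedding_at_cong[of "digit n v" f] by blast
qed (auto simp: epg_subgraph_iff)

lemma epg_subgraph_trivial:
  assumes "h \<le> 1 \<or> n < h"
  shows "epg_subgraph G H \<longleftrightarrow> h \<le> n"
proof
  assume "epg_subgraph G H"
  then obtain t f where "embedding_at t f" unfolding epg_subgraph_iff by blast
  moreover have "finite (verts G)" by (subst verts_G) simp
  ultimately show "h \<le> n"
    by (intro card_inj_on_le[of f]) (auto simp: embedding_at_def mem_verts_G mem_verts_H)
next
  assume "h \<le> n"
  then have zero: "i = 0" if "i < h" for i using assms that by linarith
  \<comment> \<open>With \<open>i = j = 0\<close> the pair \<open>{i, j}\<close> collapses to a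
    singleton, which is never an edge.\<close>
  have "{0} \<notin> edges G" "{0} \<notin> edges H" using edge_G[of "{0}"] edge_H[of "{0}"] by auto
  moreover have "i < n" if "i < h" for i using \<open>h \<le> n\<close> that by simp
  ultimately have "embedding_at 0 id"
    unfolding embedding_at_def by (auto dest!: zero)
  then show "epg_subgraph G H" unfolding epg_subgraph_iff by blast
qed

section \<open>Correctness on encoded instances and the step bound\<close>

lemma map_ok_iff:
  assumes "0 < n"
  shows "layout.map_ok n h (pattern_bit H) (entry_bit G) t v \<longleftrightarrow> embedding_at t (digit n v)"
proof -
  interpret solver_run n h x "entry_length G" "pattern_bit H" "entry_bit G" start m
    using solver_run[OF assms] .
  let ?d = "digit n v"
  have "entry_bit G (n * ?d i + ?d j) t = of_bool ({?d i, ?d j} \<in> edges G \<and> present G {?d i, ?d j} t)"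
    for i j
    using digit_less[OF assms, of v j] assms by (simp add: entry_bit_def Let_def)
  moreover have "pattern_bit H (i * h + j) = of_bool ({i, j} \<in> edges H)" if "j < h" for i j
    using that by (simp add: pattern_bit_def Let_def)
  ultimately have "pair_ok t v i j \<longleftrightarrow>
      ({?d i, ?d j} \<in> edges G \<and> present G {?d i, ?d j} t \<longleftrightarrow> {i, j} \<in> edges H) \<and>
      (?d i = ?d j \<longrightarrow> i = j)" if "j < h" for i j
    using that by (auto simp: pair_ok_def)
  then show ?thesis
    using digit_less[OF assms]
    unfolding map_ok_def embedding_at_def inj_on_def Ball_def mem_verts_H by blast
qed

lemma wp_solver_instance:
  assumes "h \<le> n" "2 \<le> h"
  shows "wp solver (171 * (n ^ h * m ^ (h * h) * (h * h)))
           (\<lambda>R M. R 0 = of_bool (epg_subgraph G H)) (\<lambda>_. 0) x"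
proof -
  have n: "0 < n" using assms by simp
  interpret solver_run n h x "entry_length G" "pattern_bit H" "entry_bit G" start m
    using solver_run[OF n] .
  let ?T = "m ^ (h * h)" and ?N = "n ^ h"
  let ?X = "?N * ?T * (h * h)"
  have N: "n * n \<le> ?N" using power_increasing[of 2 h n] assms by (simp add: power2_eq_square)
  have T: "1 \<le> ?T" "m \<le> ?T" using power_increasing[of 1 "h * h" m] m_pos assms by auto
  have hn: "h * n \<le> n * n" "h \<le> h * n" "n \<le> h * n" "h \<le> h * h" "1 \<le> h * h" using assms n by auto
  have nT: "n * n * ?T \<le> ?N * ?T" using N by simp
  have NT: "?N * ?T \<le> ?N * ?T * h" "?N * ?T * h \<le> ?X" using assms by auto
  have "n * n \<le> n * n * ?T" "?T \<le> n * n * ?T" "1 \<le> ?T" using T n by auto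
  then have small: "n * n \<le> ?X" "h \<le> ?X" "n \<le> ?X" "h * n \<le> ?X" "?T \<le> ?X" "1 \<le> ?X"
      "?N * ?T \<le> ?X" "?N * ?T * h \<le> ?X" "n * n * ?T \<le> ?X"
    using nT NT hn T by linarith+
  \<comment> \<open>Computing \<open>m ^ (h * h)\<close> takes about \<open>h * h * m\<close> steps,
    which are paid for by \<open>m \<le> ?T\<close>.\<close>
  have "m \<le> ?N * ?T" using T N n by (metis le_trans mult_le_mono nat_0_less_mult_iff mult_1 Suc_leI One_nat_def)
  then have hhm: "h * h * m \<le> ?X" by (simp add: mult.commute)
  have hh: "h * h \<le> ?X" using T n by simp
  have "4 * h + 4 * n + n * n * 8 + h * h * (4 * m + 7) + h * (4 * n + 7) +
      ?T * (n * n * 22 + ?N * (h * (h * 26 + 24) + 16) + 10) + 35 =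
      4 * h + 4 * n + 8 * (n * n) + 4 * (h * h * m) + 7 * (h * h) + 4 * (h * n) + 7 * h +
      22 * (n * n * ?T) + 26 * ?X + 24 * (?N * ?T * h) + 16 * (?N * ?T) + 10 * ?T + 35"
    by (simp add: algebra_simps)
  \<comment> \<open>The constant is the sum of all coefficients, since each term is at most
    \<open>?X\<close>.\<close>
  also have "\<dots> \<le> 171 * ?X" using small hhm hh by linarith
  finally have bound: "4 * h + 4 * n + n * n * 8 + h * h * (4 * m + 7) + h * (4 * n + 7) +
      ?T * (n * n * 22 + ?N * (h * (h * 26 + 24) + 16) + 10) + 35 \<le> 171 * ?X" .
  show ?thesis
    using wp_mono[OF wp_solver[OF x_0 x_1 assms] bound]
    by (simp add: map_ok_iff[OF n] epg_subgraph_iff_digits[OF n])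
qed

text \<open>For \<open>n = 0\<close> and positive \<open>h\<close> the product is \<open>0\<close>,
  and a nonempty program cannot halt in no steps, so only halting is claimed then. For the empty
  pattern \<open>max 1 h\<close> keeps the bound positive.\<close>

lemma solver_halts:
  "\<exists>t. halts_within (compile 0 solver) (encode G H) t (of_bool (epg_subgraph G H)) \<and>
     (n \<noteq> 0 \<longrightarrow> t \<le> 171 * (n ^ h * m ^ (h * h) * (max 1 h * max 1 h)))"
proof (cases "h \<le> 1 \<or> n < h")
  case True
  then have "x 1 \<le> 1 \<or> x 0 < x 1" unfolding x_0 x_1 .
  from halts_within_compile[OF wp_solver_trivial[OF this]] obtain t
    where t: "t \<le> 10" "halts_within (compile 0 solver) (encode G H) t (of_bool (h \<le> n))"
    unfolding x_0 x_1 by blast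
  have "t \<le> 171 * (n ^ h * m ^ (h * h) * (max 1 h * max 1 h))" if "n \<noteq> 0"
  proof -
    have "1 \<le> n ^ h * m ^ (h * h) * (max 1 h * max 1 h)"
      using that m_pos by (simp add: Suc_le_eq)
    with t(1) show ?thesis by linarith
  qed
  with t(2) show ?thesis unfolding epg_subgraph_trivial[OF True] by blast
next
  case False
  then have "h \<le> n" "2 \<le> h" by auto
  from halts_within_compile[OF wp_solver_instance[OF this]] show ?thesis
    using \<open>2 \<le> h\<close> by (simp only: max_def) auto
qed

end

text \<open>Both sides are powers of 2. In the exponent, \<open>log 2 h\<close> is the square root
  of its own square, and one of the two factors under the root is enlarged to
  \<open>h\<close>.\<close>

lemma square_le_powr_sqrt:
  fixes h :: nat
  assumes "1 \<le> h"
  shows "(real h)\<^sup>2 \<le> 2 powr (2 * sqrt (real h * log 2 (real h)))"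
proof -
  have pos: "0 \<le> log 2 h" using assms by simp
  have "log 2 h \<le> h" using assms less_exp[of h]
    by (simp add: log_le_iff powr_realpow flip: of_nat_power of_nat_le_iff)
  then have "sqrt (log 2 h * log 2 h) \<le> sqrt (h * log 2 h)"
    using pos by (intro real_sqrt_le_mono mult_right_mono) auto
  then have "log 2 h \<le> sqrt (h * log 2 h)" using pos by simp
  then have "2 powr (2 * log 2 h) \<le> 2 powr (2 * sqrt (h * log 2 h))" by simp
  also have "2 powr (2 * log 2 h) = (2 powr log 2 h)\<^sup>2"
    by (simp only: mult_2 powr_add power2_eq_square)
  also have "2 powr log 2 h = h" using assms by (intro powr_log_cancel) auto
  finally show ?thesis .
qed

theorem theorem7:
  "\<exists>(P :: instr list) (C :: real) (c :: real).
     \<forall>(G :: nat epg) (H :: nat ugraph). is_instance G H \<longrightarrow>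
       (let n = card (verts G); h = card (verts H); m = max_label_length G in
        \<exists>t. halts_within P (encode G H) t (of_bool (epg_subgraph G H)) \<and>
            (n \<noteq> 0 \<longrightarrow>
               real t \<le> C * (real n ^ h * real m ^ (h ^ 2))
                          * 2 powr (c * sqrt (real h * log 2 (real h)))))"
proof (intro exI allI impI)
  fix G :: "nat epg" and H :: "nat ugraph"
  assume "is_instance G H"
  then interpret epg_instance G H by unfold_locales
  obtain t where t: "halts_within (compile 0 solver) (encode G H) t (of_bool (epg_subgraph G H))"
      "n \<noteq> 0 \<Longrightarrow> t \<le> 171 * (n ^ h * m ^ (h * h) * (max 1 h * max 1 h))"
    using solver_halts by blast
  have "real t \<le> 171 * (real n ^ h * real m ^ h\<^sup>2) * 2 powr (2 * sqrt (real h * log 2 (real h)))"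
    if "n \<noteq> 0"
  proof -
    \<comment> \<open>For \<open>h = 0\<close> the exponent is \<open>0\<close>, and both sides are
      \<open>1\<close>.\<close>
    have sq: "(real (max 1 h))\<^sup>2 \<le> 2 powr (2 * sqrt (real h * log 2 (real h)))"
      using square_le_powr_sqrt[of h] by (cases "h = 0") (auto simp: max_def)
    have "real t \<le> real (171 * (n ^ h * m ^ (h * h) * (max 1 h * max 1 h)))"
      unfolding of_nat_le_iff by (rule t(2)[OF that])
    also have "\<dots> = 171 * (real n ^ h * real m ^ h\<^sup>2) * (real (max 1 h))\<^sup>2"
      by (simp add: power2_eq_square)
    also have "\<dots> \<le> 171 * (real n ^ h * real m ^ h\<^sup>2) * 2 powr (2 * sqrt (real h * log 2 (real h)))"
      using sq by (intro mult_left_mono) auto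
    finally show ?thesis .
  qed
  with t(1) show "let n = card (verts G); h = card (verts H); m = max_label_length G in
        \<exists>t. halts_within (compile 0 solver) (encode G H) t (of_bool (epg_subgraph G H)) \<and>
            (n \<noteq> 0 \<longrightarrow>
               real t \<le> 171 * (real n ^ h * real m ^ (h ^ 2))
                          * 2 powr (2 * sqrt (real h * log 2 (real h))))"
    unfolding Let_def by blast
qed

end
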